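(* For every simple signed permutation $\pi$ of size $n$, $$psrd(\pi)= n+1+c(BG(\pi))-2c_1(BG(\pi))+t(\pi)-\begin{cases}0 & \text{if } \pi_1=1,\\ 2 & \text{otherwise,}\end{cases}$$ where $t(\pi)=1$ if $\pi_1\neq 1$ and the leftmost component of $BG(\pi)$ is nonoriented, and $t(\pi)=0$ otherwise.
   Context: A signed permutation of size $n$ is a sequence $\pi=\langle\pi_1\ \cdots\ \pi_n\rangle$ of nonzero integers such that $(|\pi_1|,\ldots,|\pi_n|)$ is a permutation of $\{1,\ldots,n\}$; the identity is $\iota=\langle 1\ 2\ \cdots\ n\rangle$ (all signs positive). "$\pi_1=1$" means the first entry is $1$ with positive sign. For $1\le j\le n$, the prefix signed reversal $\overline{\rho}(1,j)$ transforms $\pi$ into $\langle -\pi_j\ \cdots\ -\pi_1\ \pi_{j+1}\ \cdots\ \pi_n\rangle$. $psrd(\pi)$ is the minimum number of prefix signed reversals whose successive application transforms $\pi$ into $\iota$. Breakpoint graph: let $\pi'=(\pi'_0,\ldots,\pi'_{2n+1})$ with $\pi'_0=0$, $\pi'_{2n+1}=2n+1$ and, for $1\le i\le n$, $(\pi'_{2i-1},\pi'_{2i})=(2\pi_i-1,2\pi_i)$ if $\pi_i>0$ and $(2|\pi_i|,2|\pi_i|-1)$ if $\pi_i<0$. $BG(\pi)$ has one vertex per position $p\in\{0,\ldots,2n+1\}$ (labelled $\pi'_p$); black edges join positions $2i$ and $2i+1$ ($0\le i\le n$); grey edges join the vertices labelled $2k$ and $2k+1$ ($0\le k\le n$). $BG(\pi)$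 decomposes uniquely into alternating cycles; $c(BG(\pi))$ is their number, the length of a cycle is its number of black edges, and $c_1(BG(\pi))$ is the number of cycles of length $1$. $\pi$ is simple if every cycle of $BG(\pi)$ has length at most $2$. The support of a grey edge joining positions $i<j$ is the interval of positions $[i,j]$; the grey edge is oriented if $j-i+1$ is odd, nonoriented otherwise; a cycle is oriented if it contains an oriented grey edge. Two distinct grey edges interleave if their supports overlap but neither contains the other; two cycles interleave if some grey edge of one interleaves with some grey edge of the other. A component of $BG(\pi)$ is a connected component of the graph whose vertices are the cycles of $BG(\pi)$, two cycles being adjacent when they interleave; a component is oriented if it contains an oriented cycle, nonoriented otherwise. The leftmost cycle is the cycle containing the black edge joining positions $0$ and $1$, and the leftmost component is the component containing it. *)

theory Defs
  imports Main
begin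

definition signed_perm :: "nat \<Rightarrow> int list \<Rightarrow> bool" where
  "signed_perm n xs \<longleftrightarrow>
     length xs = n \<and> distinct (map abs xs) \<and> set (map abs xs) = {1..int n}"

definition identity_perm :: "nat \<Rightarrow> int list" where
  "identity_perm n = [1..int n]"

definition prefix_signed_reversal :: "nat \<Rightarrow> int list \<Rightarrow> int list" where
  "prefix_signed_reversal j xs = map uminus (rev (take j xs)) @ drop j xs"

definition sorts :: "nat list \<Rightarrow> int list \<Rightarrow> bool" where
  "sorts js xs \<longleftrightarrow> set js \<subseteq> {1..length xs} \<and>
     fold prefix_signed_reversal js xs = identity_perm (length xs)"

definition psrd :: "int list \<Rightarrow> nat" where
  "psrd xs = (LEAST k. \<exists>js. length js = k \<and> sorts js xs)"

definition labels :: "int list \<Rightarrow> int list" where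
  "labels xs =
     0 # concat (map (\<lambda>x. if x > 0 then [2 * x - 1, 2 * x] else [2 * \<bar>x\<bar>, 2 * \<bar>x\<bar> - 1]) xs)
       @ [2 * int (length xs) + 1]"

text \<open>
  The vertices of the breakpoint graph are the positions \<open>p < length (labels xs)\<close>, the label of
  \<open>p\<close> being \<open>labels xs ! p\<close>. An edge is the set of its two endpoints. A black and a grey edge may
  have the same endpoints, so the two families are kept apart.
\<close>

definition black_edges :: "int list \<Rightarrow> nat set set" where
  "black_edges xs = {{2 * i, 2 * i + 1} | i. i \<le> length xs}"

definition grey_edges :: "int list \<Rightarrow> nat set set" where
  "grey_edges xs =
     {{p, q} | p q. p < length (labels xs) \<and> q < length (labels xs) \<and>
        (\<exists>k \<le> length xs. labels xs ! p = 2 * int k \<and> labels xs ! q = 2 * int k + 1)}"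

definition alternating_cycle :: "int list \<Rightarrow> nat list \<Rightarrow> bool" where
  "alternating_cycle xs ps \<longleftrightarrow>
     distinct ps \<and>
     (\<exists>l \<ge> 1. length ps = 2 * l \<and>
       (\<forall>i < l. {ps ! (2 * i), ps ! (2 * i + 1)} \<in> black_edges xs \<and>
                {ps ! (2 * i + 1), ps ! ((2 * i + 2) mod (2 * l))} \<in> grey_edges xs))"

text \<open>
  Every vertex is an endpoint of exactly one black and exactly one grey edge, so an alternating
  cycle is determined by its vertex set. Cycles are identified with their vertex sets, which makes
  the choice of starting point and direction irrelevant.
\<close>

definition cycles :: "int list \<Rightarrow> nat set set" where
  "cycles xs = {set ps | ps. alternating_cycle xs ps}"

definition cycle_black_edges :: "int list \<Rightarrow> nat set \<Rightarrow> nat set set" where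
  "cycle_black_edges xs C = {e \<in> black_edges xs. e \<subseteq> C}"

definition cycle_grey_edges :: "int list \<Rightarrow> nat set \<Rightarrow> nat set set" where
  "cycle_grey_edges xs C = {e \<in> grey_edges xs. e \<subseteq> C}"

definition cycle_length :: "int list \<Rightarrow> nat set \<Rightarrow> nat" where
  "cycle_length xs C = card (cycle_black_edges xs C)"

definition num_cycles :: "int list \<Rightarrow> nat" where
  "num_cycles xs = card (cycles xs)"

definition num_1_cycles :: "int list \<Rightarrow> nat" where
  "num_1_cycles xs = card {C \<in> cycles xs. cycle_length xs C = 1}"

definition simple_perm :: "int list \<Rightarrow> bool" where
  "simple_perm xs \<longleftrightarrow> (\<forall>C \<in> cycles xs. cycle_length xs C \<le> 2)"

definition support :: "nat set \<Rightarrow> nat set" where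
  "support e = {Min e..Max e}"

definition oriented_edge :: "nat set \<Rightarrow> bool" where
  "oriented_edge e \<longleftrightarrow> odd (Max e - Min e + 1)"

definition oriented_cycle :: "int list \<Rightarrow> nat set \<Rightarrow> bool" where
  "oriented_cycle xs C \<longleftrightarrow> (\<exists>e \<in> cycle_grey_edges xs C. oriented_edge e)"

definition interleaving_edges :: "nat set \<Rightarrow> nat set \<Rightarrow> bool" where
  "interleaving_edges e f \<longleftrightarrow>
     e \<noteq> f \<and> support e \<inter> support f \<noteq> {} \<and>
     \<not> support e \<subseteq> support f \<and> \<not> support f \<subseteq> support e"

definition interleaving_cycles :: "int list \<Rightarrow> nat set \<Rightarrow> nat set \<Rightarrow> bool" where
  "interleaving_cycles xs C D \<longleftrightarrow>
     (\<exists>e \<in> cycle_grey_edges xs C. \<exists>f \<in> cycle_grey_edges xs D. interleaving_edges e f)"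

definition interleaving_rel :: "int list \<Rightarrow> (nat set \<times> nat set) set" where
  "interleaving_rel xs =
     {(C, D). C \<in> cycles xs \<and> D \<in> cycles xs \<and> interleaving_cycles xs C D}"

definition components :: "int list \<Rightarrow> nat set set set" where
  "components xs = cycles xs // (interleaving_rel xs)\<^sup>*"

definition oriented_component :: "int list \<Rightarrow> nat set set \<Rightarrow> bool" where
  "oriented_component xs K \<longleftrightarrow> (\<exists>C \<in> K. oriented_cycle xs C)"

definition leftmost_cycle :: "int list \<Rightarrow> nat set" where
  "leftmost_cycle xs = (THE C. C \<in> cycles xs \<and> {0, 1} \<in> cycle_black_edges xs C)"

definition leftmost_component :: "int list \<Rightarrow> nat set set" where
  "leftmost_component xs = (THE K. K \<in> components xs \<and> leftmost_cycle xs \<in> K)"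

definition t_correction :: "int list \<Rightarrow> nat" where
  "t_correction xs =
     (if hd xs \<noteq> 1 \<and> \<not> oriented_component xs (leftmost_component xs) then 1 else 0)"

end

theory Submission
  imports Defs "HOL-Combinatorics.Cycles"
begin

text \<open>
  A permutation is encoded by the function \<open>P\<close> sending each label of the breakpoint graph to its
  position, extended by the identity beyond the last label. Grey edges then join a label \<open>v\<close> to
  \<open>mate v\<close>, black edges join it to \<open>black P v\<close>, and reversing the elements at places
  \<open>k + 1, ..., l\<close> composes \<open>P\<close> with \<open>rv k l\<close>, which changes just two black edges.

  Lower bound: \<open>n + 1 + c - 2 c\<^sub>1 - (0 or 2)\<close> drops by at most one per prefix reversal. It drops only
  if the leftmost cycle absorbs a nontrivial cycle or loses a cycle of length one, so while it drops
  the leftmost cycle behaves like a stack on top of the original one. When the original first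
  vertex is back on top, some black edges have been replaced by grey ones and all others are
  untouched; if the leftmost component is nonoriented this cannot have changed the direction in
  which its edges are traversed, so the first vertex can never be split off. Hence a
  nonoriented leftmost component costs an additional step.

  Upper bound, for simple permutations: split an oriented leftmost cycle in one step; remove any
  other oriented cycle in three steps (if \<open>\<pi>\<^sub>1 \<noteq> 1\<close>, one closest to the leftmost cycle, so that the
  leftmost component stays oriented); if the leftmost component is nonoriented, one reversal
  orients a cycle crossing the leftmost cycle; and if \<open>\<pi>\<^sub>1 = 1\<close> and no cycle is oriented, two
  reversals move a nonoriented cycle to the left end and orient a cycle crossing it.
\<close>

section \<open>Arrangements of labels\<close>

text \<open>Labels stay fixed while positions move, so grey edges are the constant map
  \<open>mate\<close> and a reversal shows only in \<open>black\<close>. A sorting sequence may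
  leave the simple permutations at once, so the lower bound treats cycles of any length. Its
  obstacle: the potential counts cycles but does not see orientation, and flips can change
  orientations and components freely. Hence no invariant of the current leftmost component is
  carried along; each state is compared with the starting arrangement \<open>P\<^sub>0\<close>. The
  constants: with F cycles of length two in a simple permutation, \<open>n + 1 + c - 2 c_1\<close>
  is 3 F. Reversing an inner block takes three flips (bring it to the front, flip it there, flip
  back); an oriented leftmost cycle has its block at the front and takes one, which saves the 2. A
  nonoriented leftmost component first needs one flip to become oriented, which is
  \<open>t\<close>.\<close>

definition mate :: "nat \<Rightarrow> nat" where
  "mate v = (if even v then v + 1 else v - 1)"

text \<open>Pairs the two labels (or positions) of one element. Commuting with it forces
  \<open>P 0 = 0\<close>, as 0 is the only fixed point, and
  \<open>P (2 * n + 1) = 2 * n + 1\<close>, as the partner \<open>2 * n + 2\<close> lies outside the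
  graph and stays put.\<close>

definition elem_mate :: "nat \<Rightarrow> nat" where
  "elem_mate v = (if v = 0 then 0 else if odd v then v + 1 else v - 1)"

definition rv :: "nat \<Rightarrow> nat \<Rightarrow> nat \<Rightarrow> nat" where
  "rv k l p = (if 2 * k + 1 \<le> p \<and> p \<le> 2 * l then 2 * k + 1 + 2 * l - p else p)"

definition adm :: "nat \<Rightarrow> (nat \<Rightarrow> nat) \<Rightarrow> bool" where
  "adm n P \<longleftrightarrow> P permutes {..<2 * n + 2} \<and> (\<forall>v. P (elem_mate v) = elem_mate (P v))"

text \<open>The pairing of 2i with 2i+1 plays two roles: on labels it is the grey edge, on positions
  the black edge. Here the second one is transported to labels.\<close>

definition black :: "(nat \<Rightarrow> nat) \<Rightarrow> nat \<Rightarrow> nat" where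
  "black P v = inv P (mate (P v))"

lemma mate_mate [simp]: "mate (mate v) = v"
  by (auto simp: mate_def elim: oddE)

lemma mate_neq [simp]: "mate v \<noteq> v" "v \<noteq> mate v"
  by (auto simp: mate_def elim: oddE)

lemma even_mate [simp]: "even (mate v) \<longleftrightarrow> odd v"
  by (auto simp: mate_def)

lemma mate_eq_iff [simp]: "mate u = mate v \<longleftrightarrow> u = v"
  by (metis mate_mate)

lemma mate_eq_swap: "mate u = v \<longleftrightarrow> u = mate v"
  by auto

lemma mate_0 [simp]: "mate 0 = 1" and mate_1 [simp]: "mate (Suc 0) = 0"
  by (auto simp: mate_def)

lemma mate_eq_0_iff [simp]: "mate v = 0 \<longleftrightarrow> v = Suc 0" "0 = mate v \<longleftrightarrow> v = Suc 0"
    "mate v = Suc 0 \<longleftrightarrow> v = 0" "Suc 0 = mate v \<longleftrightarrow> v = 0"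
  by (auto simp: mate_def elim: oddE)

lemma mate_double [simp]: "mate (2 * k) = Suc (2 * k)" "mate (Suc (2 * k)) = 2 * k"
  by (auto simp: mate_def)

lemma mate_less_iff [simp]: "mate v < 2 * n + 2 \<longleftrightarrow> v < 2 * n + 2"
  unfolding mate_def by presburger

lemma mate_less_iff' [simp]: "mate v < Suc (Suc (2 * n)) \<longleftrightarrow> v < Suc (Suc (2 * n))"
  using mate_less_iff[of v n] by simp

lemma elem_mate_involutive [simp]: "elem_mate (elem_mate v) = v"
  by (auto simp: elem_mate_def elim: oddE)

lemma elem_mate_eq_self_iff: "elem_mate v = v \<longleftrightarrow> v = 0"
  by (auto simp: elem_mate_def elim: oddE)

lemma rv_rv [simp]: "rv k l (rv k l p) = p"
  by (auto simp: rv_def)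

lemma rv_outside: "p \<le> 2 * k \<or> 2 * l < p \<Longrightarrow> rv k l p = p"
  by (auto simp: rv_def)

lemma rv_eq_0_iff [simp]: "rv k l p = 0 \<longleftrightarrow> p = 0" and rv_0 [simp]: "rv k l 0 = 0"
  by (auto simp: rv_def)

lemma elem_mate_Suc [simp]: "elem_mate (Suc (2 * i)) = Suc (Suc (2 * i))"
    "elem_mate (Suc (Suc (2 * i))) = Suc (2 * i)"
  by (auto simp: elem_mate_def)

lemma elem_cases:
  obtains "p = 0" | i where "p = Suc (2 * i)" | i where "p = Suc (Suc (2 * i))"
proof (cases p)
  case (Suc q)
  then show ?thesis using that by (cases "even q") (auto elim!: evenE oddE)
qed (use that in auto)

lemma rv_Suc:
  "rv k l (Suc (2 * i)) = (if k \<le> i \<and> i < l then Suc (Suc (2 * (k + l - i - 1))) else Suc (2 * i))"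
  "rv k l (Suc (Suc (2 * i))) = (if k \<le> i \<and> i < l then Suc (2 * (k + l - i - 1)) else Suc (Suc (2 * i)))"
  unfolding rv_def by auto

lemma rv_elem_mate: "rv k l (elem_mate p) = elem_mate (rv k l p)"
  by (cases p rule: elem_cases) (simp_all add: rv_Suc, simp add: elem_mate_def rv_def)

lemma bij_rv: "bij (rv k l)"
  by (rule o_bij[of "rv k l"]) (auto simp: fun_eq_iff)

lemma inv_rv [simp]: "inv (rv k l) = rv k l"
  by (rule inv_unique_comp) (auto simp: fun_eq_iff)

lemma rv_permutes: "l \<le> n \<Longrightarrow> rv k l permutes {..<2 * n + 2}"
  using bij_rv[of k l] by (simp add: permutes_def bij_iff rv_outside)

lemma even_rv: "even (rv k l p) \<longleftrightarrow> (if 2 * k + 1 \<le> p \<and> p \<le> 2 * l then odd p else even p)"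
  by (auto simp: rv_def)

lemma rv_in_iff: "2 * k + 1 \<le> rv k l p \<and> rv k l p \<le> 2 * l \<longleftrightarrow> 2 * k + 1 \<le> p \<and> p \<le> 2 * l"
  unfolding rv_def by auto

lemma adm_bij: "adm n P \<Longrightarrow> bij P"
  by (auto simp: adm_def permutes_bij)

lemma adm_0 [simp]: "adm n P \<Longrightarrow> P 0 = 0"
proof -
  assume "adm n P"
  then have "P (elem_mate 0) = elem_mate (P 0)" unfolding adm_def by blast
  moreover have "elem_mate 0 = 0" by (simp add: elem_mate_def)
  ultimately show ?thesis using elem_mate_eq_self_iff[of "P 0"] by simp
qed

lemma adm_outside: "adm n P \<Longrightarrow> v \<ge> 2 * n + 2 \<Longrightarrow> P v = v"
  unfolding adm_def using permutes_not_in[of P "{..<2 * n + 2}" v] by simp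

lemma adm_in [simp]: "adm n P \<Longrightarrow> P v < 2 * n + 2 \<longleftrightarrow> v < 2 * n + 2"
  unfolding adm_def using permutes_in_image[of P "{..<2 * n + 2}" v] by simp

lemma adm_rv: "adm n P \<Longrightarrow> l \<le> n \<Longrightarrow> adm n (rv k l \<circ> P)"
  using rv_permutes[of l n k] by (auto simp: adm_def rv_elem_mate intro!: permutes_compose)

lemma P_black [simp]: "bij P \<Longrightarrow> P (black P v) = mate (P v)"
  by (simp add: black_def bij_is_surj surj_f_inv_f)

lemma inv_P [simp]: "bij P \<Longrightarrow> inv P (P v) = v" "bij P \<Longrightarrow> P (inv P p) = p"
  by (simp_all add: bij_is_inj bij_is_surj surj_f_inv_f)

lemma black_black [simp]: "bij P \<Longrightarrow> black P (black P v) = v"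
  by (simp add: black_def)

lemma black_neq [simp]: "bij P \<Longrightarrow> black P v \<noteq> v" "bij P \<Longrightarrow> v \<noteq> black P v"
  by (metis P_black mate_neq)+

lemma black_eq_iff: "bij P \<Longrightarrow> black P u = v \<longleftrightarrow> P v = mate (P u)"
  by (metis P_black inv_P(1))

lemma black_in [simp]: "adm n P \<Longrightarrow> black P v < 2 * n + 2 \<longleftrightarrow> v < 2 * n + 2"
  using adm_in[of n P "black P v"] adm_in[of n P v] mate_less_iff[of "P v" n]
  by (simp add: adm_bij)

lemma black_id: "black id = mate"
  by (auto simp: black_def fun_eq_iff)

text \<open>The reflection carries each pair 2i, 2i+1 with k < i < l onto another such pair; only
  the pairs at 2k and 2l have one end moved and are joined anew.\<close>

lemma black_rv:
  assumes "bij P" "k < l"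
  shows "black (rv k l \<circ> P) v =
    (if P v = 2 * k then inv P (2 * l) else if P v = 2 * k + 1 then inv P (2 * l + 1)
     else if P v = 2 * l then inv P (2 * k) else if P v = 2 * l + 1 then inv P (2 * k + 1)
     else black P v)"
proof -
  have "black (rv k l \<circ> P) v = inv P (rv k l (mate (rv k l (P v))))"
    using assms by (simp add: black_def o_inv_distrib bij_rv)
  moreover have "rv k l (mate (rv k l p)) = (if p = 2 * k then 2 * l else if p = 2 * k + 1 then 2 * l + 1
     else if p = 2 * l then 2 * k else if p = 2 * l + 1 then 2 * k + 1 else mate p)" for p
    using assms(2) by (cases "even p") (auto simp: rv_def mate_def elim!: oddE evenE)
  ultimately show ?thesis by (simp add: black_def)
qed

section \<open>Alternating cycles as orbits of two involutions\<close>

definition orb :: "('a \<Rightarrow> 'a) \<Rightarrow> ('a \<Rightarrow> 'a) \<Rightarrow> 'a \<Rightarrow> 'a set" where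
  "orb f g v = ({(u, f u) | u. True} \<union> {(u, g u) | u. True})\<^sup>* `` {v}"

lemma orb_self [simp]: "v \<in> orb f g v"
  by (auto simp: orb_def)

lemma orb_step: "u \<in> orb f g v \<Longrightarrow> f u \<in> orb f g v" "u \<in> orb f g v \<Longrightarrow> g u \<in> orb f g v"
  unfolding orb_def by (auto intro: rtrancl_into_rtrancl)

lemma orb_induct [consumes 1, case_names self left right]:
  assumes "u \<in> orb f g v" "Q v" "\<And>u. u \<in> orb f g v \<Longrightarrow> Q u \<Longrightarrow> Q (f u)" "\<And>u. u \<in> orb f g v \<Longrightarrow> Q u \<Longrightarrow> Q (g u)"
  shows "Q u"
proof -
  have "(v, u) \<in> ({(u, f u) | u. True} \<union> {(u, g u) | u. True})\<^sup>*" using assms(1) by (auto simp: orb_def)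
  then have "u \<in> orb f g v \<and> Q u"
  proof (induction rule: rtrancl_induct)
    case (step y z)
    then have "z = f y \<or> z = g y" by auto
    with step.IH assms(3,4)[of y] orb_step[of y f g v] show ?case by metis
  qed (simp add: assms(2))
  then show ?thesis ..
qed

lemma orb_subset:
  assumes "v \<in> S" "\<And>u. u \<in> S \<Longrightarrow> f u \<in> S" "\<And>u. u \<in> S \<Longrightarrow> g u \<in> S"
  shows "orb f g v \<subseteq> S"
proof
  fix u assume "u \<in> orb f g v"
  then show "u \<in> S" by (induction rule: orb_induct) (blast intro: assms)+
qed

lemma orb_trans: "u \<in> orb f g v \<Longrightarrow> orb f g u \<subseteq> orb f g v"
  by (rule orb_subset) (assumption | rule orb_step)+

lemma orb_sym:
  assumes "\<And>v. f (f v) = v" "\<And>v. g (g v) = v" "u \<in> orb f g v"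
  shows "v \<in> orb f g u"
  using assms(3)
proof (induction rule: orb_induct)
  case (left u)
  have "u \<in> orb f g (f u)" using orb_step(1)[of "f u" f g "f u"] assms(1) by simp
  then have "orb f g u \<subseteq> orb f g (f u)" by (rule orb_trans)
  with left show ?case by auto
next
  case (right u)
  have "u \<in> orb f g (g u)" using orb_step(2)[of "g u" f g "g u"] assms(2) by simp
  then have "orb f g u \<subseteq> orb f g (g u)" by (rule orb_trans)
  with right show ?case by auto
qed simp

lemma orb_eq:
  assumes "\<And>v. f (f v) = v" "\<And>v. g (g v) = v" "u \<in> orb f g v"
  shows "orb f g u = orb f g v"
  using orb_trans[OF assms(3)] orb_trans[OF orb_sym[OF assms]] by auto

lemma orb_cong_on:
  assumes "\<And>u. u \<in> orb f g v \<Longrightarrow> f' u = f u"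
  shows "orb f' g v = orb f g v"
proof
  show "orb f' g v \<subseteq> orb f g v"
    by (rule orb_subset) (simp_all only: assms orb_self orb_step)
  show "orb f g v \<subseteq> orb f' g v"
  proof
    fix u assume "u \<in> orb f g v"
    then show "u \<in> orb f' g v"
    proof (induction rule: orb_induct)
      case (left u)
      then show ?case using orb_step(1)[of u f' g v] assms[of u] by simp
    next
      case (right u)
      then show ?case by (rule_tac orb_step(2))
    qed simp
  qed
qed

section \<open>The potential\<close>

lemma orb_lt:
  assumes "\<And>v. b v < 2 * n + 2 \<longleftrightarrow> v < 2 * n + (2::nat)" "v < 2 * n + 2"
  shows "orb b mate v \<subseteq> {..<2 * n + 2}"
  by (rule orb_subset) (use assms in \<open>auto simp: mate_less_iff[simplified]\<close>)

lemma card_mate_closed: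
  assumes "finite A" "\<And>v. v \<in> A \<Longrightarrow> mate v \<in> A"
  shows "card A = 2 * card {v \<in> A. even v}"
proof -
  let ?E = "{v \<in> A. even v}"
  have "A = ?E \<union> mate ` ?E"
  proof (intro equalityI subsetI)
    fix v assume "v \<in> A"
    then show "v \<in> ?E \<union> mate ` ?E"
      using assms(2)[of v] image_eqI[of v mate "mate v" ?E] by (cases "even v") auto
  qed (use assms(2) in auto)
  then have "card A = card (?E \<union> mate ` ?E)" by simp
  also have "\<dots> = card ?E + card (mate ` ?E)"
    by (rule card_Un_disjoint) (use assms(1) in auto)
  also have "card (mate ` ?E) = card ?E"
    by (rule card_image) (auto simp: inj_on_def)
  finally show ?thesis by simp
qed

text \<open>A finite set closed under a fixed-point-free involution has even size. If the partner of
  \<open>p\<close> were missing, both \<open>A\<close> (under \<open>mate\<close>) and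
  \<open>A - {p}\<close> (under \<open>black P\<close>) would be even. This replaces walking along a
  cycle up to its last edge.\<close>

lemma black_mem_of_parity:
  assumes P: "bij P" and A: "finite A" "\<And>v. v \<in> A \<Longrightarrow> mate v \<in> A"
    and p: "p \<in> A" "\<And>v. v \<in> A \<Longrightarrow> v \<noteq> p \<Longrightarrow> black P v \<in> A"
  shows "black P p \<in> A"
proof (rule ccontr)
  assume n: "black P p \<notin> A"
  have "mate w \<in> P ` (A - {p})" if "w \<in> P ` (A - {p})" for w
  proof -
    from that obtain v where v: "v \<in> A" "v \<noteq> p" "w = P v" by auto
    have "black P v \<noteq> p" using n v(1) black_black[OF P, of v] by auto
    then show ?thesis using v p(2)[of v] P_black[OF P, of v] by (metis DiffI image_eqI singletonD)
  qed
  then have "even (card (P ` (A - {p})))" using A(1) by (subst card_mate_closed) auto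
  then have "even (card (A - {p}))"
    by (subst (asm) card_image) (auto intro: inj_on_subset[OF bij_is_inj[OF P]])
  moreover have "even (card A)" using card_mate_closed[OF A] by simp
  ultimately show False using p(1) A(1) card_Suc_Diff1[OF A(1) p(1)] by (metis even_Suc)
qed

definition breaks :: "nat \<Rightarrow> (nat \<Rightarrow> nat) \<Rightarrow> nat set" where
  "breaks n b = {v. 1 < v \<and> v < 2 * n + 2 \<and> b v \<noteq> mate v}"

definition num_orbs :: "nat \<Rightarrow> (nat \<Rightarrow> nat) \<Rightarrow> nat" where
  "num_orbs n b = card (orb b mate ` {..<2 * n + 2})"

text \<open>
  \<open>breaks\<close> has two labels for each grey edge in a nontrivial cycle, except for the edge joining the
  labels 0 and 1, so this is \<open>n + 1 + c - 2 c\<^sub>1\<close>, less 2 if \<open>\<pi>\<^sub>1 \<noteq> 1\<close>.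
\<close>

definition potential :: "nat \<Rightarrow> (nat \<Rightarrow> nat) \<Rightarrow> int" where
  "potential n b = int (num_orbs n b) + int (card (breaks n b)) - int n - 1"

text \<open>The effect of one prefix flip on labels, with \<open>x\<close>, \<open>y\<close>,
  \<open>z\<close> the labels at positions 1, 2j, 2j+1: the black edges 0-x and y-z give way to 0-y
  and x-z.\<close>

locale black_swap =
  fixes n :: nat and b b' :: "nat \<Rightarrow> nat" and x y z :: nat
  assumes inv_b: "b (b v) = v" and inv_b': "b' (b' v) = v"
    and b_V: "b v < 2 * n + 2 \<longleftrightarrow> v < 2 * n + 2"
    and b'_V: "b' v < 2 * n + 2 \<longleftrightarrow> v < 2 * n + 2"
    and old: "b 0 = x" "b y = z" and new: "b' 0 = y" "b' x = z"
    and other: "v \<notin> {0, x, y, z} \<Longrightarrow> b' v = b v"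
    and dist: "distinct [0, x, y, z]"
    and y_V: "y < 2 * n + 2"
begin

lemma old': "b x = 0" "b z = y" and new': "b' y = 0" "b' z = x"
  using inv_b inv_b' old new by metis+

lemma vertices_V: "x < 2 * n + 2" "z < 2 * n + 2"
  using b_V[of 0] b_V[of y] old y_V by auto

text \<open>Old orbits other than those of 0 and \<open>y\<close> contain no end of an exchanged
  edge and survive unchanged; they are disjoint from the members of \<open>B\<close>, each of which
  contains such an end.\<close>

lemma num_orbs_ge:
  assumes B: "B \<subseteq> orb b' mate ` {..<2 * n + 2}" "\<And>C. C \<in> B \<Longrightarrow> 0 \<in> C \<or> x \<in> C \<or> y \<in> C \<or> z \<in> C"
  shows "num_orbs n b + card B \<le> num_orbs n b' + card {orb b mate 0, orb b mate y}"
proof -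
  let ?V = "{..<2 * n + 2}" and ?old = "{orb b mate 0, orb b mate y}"
  define A where "A = orb b mate ` ?V - ?old"
  have A: "C \<in> orb b' mate ` ?V \<and> C \<inter> {0, x, y, z} = {}" if "C \<in> A" for C
  proof -
    from that obtain v where v: "v \<in> ?V" "C = orb b mate v" "C \<notin> ?old" by (auto simp: A_def)
    have eq: "orb b mate u = C" if "u \<in> C" for u
      using that orb_eq[of b mate u v] inv_b v(2) by simp
    have "0 \<notin> C" "y \<notin> C" using eq[of 0] eq[of y] v(3) by auto
    moreover then have "x \<notin> C" "z \<notin> C"
      using orb_step(1)[of x b mate v] orb_step(1)[of z b mate v] old' v(2) by auto
    ultimately have disj: "C \<inter> {0, x, y, z} = {}" by auto
    have "b' u = b u" if "u \<in> orb b mate v" for u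
      using other[of u] disj that v(2) by blast
    then have "orb b' mate v = C" unfolding v(2) by (rule orb_cong_on)
    with v(1) disj show ?thesis by auto
  qed
  have "card A + card B = card (A \<union> B)"
    using A B(2) by (intro card_Un_disjoint[symmetric]) (auto simp: A_def intro: finite_subset[OF B(1)])
  also have "\<dots> \<le> num_orbs n b'"
    unfolding num_orbs_def using A B(1) by (intro card_mono) auto
  finally have "card A + card B \<le> num_orbs n b'" .
  moreover have "num_orbs n b \<le> card A + card ?old"
    unfolding num_orbs_def A_def by (metis card_Diff1_le diff_card_le_card_Diff finite.emptyI finite.insertI le_diff_conv)
  ultimately show ?thesis by linarith
qed

lemma num_orbs_merge: "num_orbs n b \<le> num_orbs n b' + 1"
  using num_orbs_ge[of "{orb b' mate 0}"] card_insert_le_m1[of 2 "{orb b mate y}" "orb b mate 0"] by simp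

lemma num_orbs_same:
  assumes "y \<in> orb b mate 0"
  shows "num_orbs n b \<le> num_orbs n b'"
proof -
  have "orb b mate y = orb b mate 0" using assms inv_b by (intro orb_eq) auto
  then show ?thesis using num_orbs_ge[of "{orb b' mate 0}"] by simp
qed

text \<open>The new black edge x-z lies parallel to a grey edge, so {x, z} closes up as a cycle of
  length one. The four labels were on one old cycle, which also loses no other part.\<close>

lemma num_orbs_split:
  assumes "mate x = z"
  shows "num_orbs n b + 1 \<le> num_orbs n b'"
proof -
  have "x \<in> orb b mate 0" using orb_step(1)[of 0 b mate 0] old by simp
  then have "z \<in> orb b mate 0" using orb_step(2)[of x b mate 0] assms by simp
  then have "y \<in> orb b mate 0" using orb_step(1)[of z b mate 0] old' by simp
  then have "orb b mate y = orb b mate 0" using inv_b by (intro orb_eq) auto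
  moreover have "orb b' mate x \<subseteq> {x, z}"
    using assms new new' by (intro orb_subset) auto
  then have "orb b' mate x \<noteq> orb b' mate 0" using orb_self[of 0 b' mate] dist by auto
  moreover have "num_orbs n b + card {orb b' mate 0, orb b' mate x} \<le> num_orbs n b' + card {orb b mate 0, orb b mate y}"
    by (rule num_orbs_ge) (use vertices_V(1) orb_self[of 0 b' mate] orb_self[of x b' mate] in auto)
  ultimately show ?thesis by (simp add: card_insert_if)
qed

lemma finite_breaks: "finite (breaks n b)" "finite (breaks n b')"
  by (auto simp: breaks_def)

lemma breaks_split:
  assumes "mate x = z"
  shows "breaks n b' = breaks n b - {x, z}" "{x, z} \<subseteq> breaks n b"
proof -
  have [simp]: "mate z = x" using assms by auto
  have "x \<noteq> 1" "z \<noteq> 1" using assms dist mate_1 by auto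
  then have gt: "1 < x" "1 < z" using dist by auto
  show "{x, z} \<subseteq> breaks n b"
    using gt assms old' dist vertices_V by (auto simp: breaks_def)
  show "breaks n b' = breaks n b - {x, z}"
  proof (rule set_eqI)
    fix v
    consider "v = 0" | "v = x" | "v = y" | "v = z" | "v \<notin> {0, x, y, z}" by blast
    then show "v \<in> breaks n b' \<longleftrightarrow> v \<in> breaks n b - {x, z}"
    proof cases
      case 3
      have "z \<noteq> mate y" using assms dist by auto
      moreover have "1 < y \<Longrightarrow> 0 \<noteq> mate y" by (auto simp: mate_def)
      ultimately show ?thesis using 3 new' old dist by (auto simp: breaks_def)
    qed (use assms new new' dist other in \<open>auto simp: breaks_def\<close>)
  qed
qed

lemma breaks_trivial:
  assumes "mate y = z"
  shows "breaks n b' = breaks n b \<union> {y, z}" "breaks n b \<inter> {y, z} = {}"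
proof -
  have [simp]: "mate z = y" using assms by auto
  have "y \<noteq> 1" "z \<noteq> 1" using assms dist mate_1 by auto
  then have gt: "1 < y" "1 < z" using dist by auto
  show "breaks n b \<inter> {y, z} = {}"
    using assms old old' dist vertices_V by (auto simp: breaks_def)
  show "breaks n b' = breaks n b \<union> {y, z}"
  proof (rule set_eqI)
    fix v
    consider "v = 0" | "v = x" | "v = y" | "v = z" | "v \<notin> {0, x, y, z}" by blast
    then show "v \<in> breaks n b' \<longleftrightarrow> v \<in> breaks n b \<union> {y, z}"
    proof cases
      case 2
      have "z \<noteq> mate x" using assms dist by auto
      moreover have "1 < x \<Longrightarrow> 0 \<noteq> mate x" by (auto simp: mate_def)
      ultimately show ?thesis using 2 new old' dist by (auto simp: breaks_def)
    next
      case 3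
      have "0 \<noteq> mate y" using gt by (auto simp: mate_def)
      then show ?thesis using 3 new' gt y_V by (auto simp: breaks_def)
    next
      case 4
      then show ?thesis using new' dist gt vertices_V by (auto simp: breaks_def)
    qed (use assms new new' dist other in \<open>auto simp: breaks_def\<close>)
  qed
qed

lemma breaks_same:
  assumes "mate x \<noteq> z" "mate y \<noteq> z"
  shows "breaks n b' = breaks n b"
proof (rule set_eqI)
  fix v
  have m: "mate z \<noteq> x" "mate z \<noteq> y" using assms by auto
  have m0: "1 < v \<Longrightarrow> 0 \<noteq> mate v" for v by (auto simp: mate_def)
  consider "v = 0" | "v = x" | "v = y" | "v = z" | "v \<notin> {0, x, y, z}" by blast
  then show "v \<in> breaks n b' \<longleftrightarrow> v \<in> breaks n b"
    by cases (use assms m m0 new new' old old' dist other in \<open>auto simp: breaks_def\<close>)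
qed

text \<open>Splitting off {x, z} gains at least one cycle and loses two breaks. Absorbing a cycle
  {y, z} of length one loses at most one cycle but gains two breaks. Otherwise the breaks stay, and
  a cycle can be lost only if \<open>y\<close> was off the leftmost one.\<close>

lemma potential_cases:
  "potential n b - 1 \<le> potential n b'"
  "potential n b' < potential n b \<Longrightarrow> mate x = z \<or> (y \<notin> orb b mate 0 \<and> mate y \<noteq> z)"
proof -
  consider "mate x = z" | "mate x \<noteq> z" "mate y = z" | "mate x \<noteq> z" "mate y \<noteq> z" by blast
  then have "potential n b - 1 \<le> potential n b' \<and>
    (potential n b' < potential n b \<longrightarrow> mate x = z \<or> (y \<notin> orb b mate 0 \<and> mate y \<noteq> z))"
  proof cases
    case 1
    have "card (breaks n b') + 2 = card (breaks n b)"
      using breaks_split[OF 1] finite_breaks dist card_mono[OF finite_breaks(1) breaks_split(2)[OF 1]]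
      by (subst breaks_split(1)[OF 1], subst card_Diff_subset) auto
    with num_orbs_split[OF 1] 1 show ?thesis by (simp add: potential_def)
  next
    case 2
    have "card (breaks n b') = card (breaks n b) + 2"
      using breaks_trivial[OF 2(2)] finite_breaks dist
      by (subst breaks_trivial(1)[OF 2(2)], subst card_Un_disjoint) auto
    with num_orbs_merge 2 show ?thesis by (simp add: potential_def)
  next
    case 3
    then show ?thesis using num_orbs_merge num_orbs_same breaks_same[OF 3] 
      by (auto simp: potential_def)
  qed
  then show "potential n b - 1 \<le> potential n b'"
    "potential n b' < potential n b \<Longrightarrow> mate x = z \<or> (y \<notin> orb b mate 0 \<and> mate y \<noteq> z)" by auto
qed

end

lemma prefix_black_swap:
  assumes P: "adm n P" and j: "1 \<le> j" "j \<le> n"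
  shows "black_swap n (black P) (black (rv 0 j \<circ> P)) (inv P 1) (inv P (2 * j)) (inv P (2 * j + 1))"
proof
  note bij = adm_bij[OF P]
  have P': "adm n (rv 0 j \<circ> P)" using P j by (intro adm_rv)
  note bij' = adm_bij[OF P']
  have inv0: "inv P 0 = 0" using inv_P(1)[OF bij, of 0] P by simp
  have br: "black (rv 0 j \<circ> P) v = (if P v = 0 then inv P (2 * j) else if P v = 1 then inv P (2 * j + 1)
     else if P v = 2 * j then inv P 0 else if P v = 2 * j + 1 then inv P 1 else black P v)" for v
    using black_rv[OF bij, of 0 j v] j by simp
  have dbl: "black P (inv P p) = inv P (mate p)" for p using bij by (simp add: black_def)
  fix v
  show "black P (black P v) = v" "black (rv 0 j \<circ> P) (black (rv 0 j \<circ> P) v) = v"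
    using bij bij' by simp_all
  show "black P v < 2 * n + 2 \<longleftrightarrow> v < 2 * n + 2" "black (rv 0 j \<circ> P) v < 2 * n + 2 \<longleftrightarrow> v < 2 * n + 2"
    using black_in[OF P] black_in[OF P'] by auto
  show "black P 0 = inv P 1" using dbl[of 0] inv0 by simp
  show "black P (inv P (2 * j)) = inv P (2 * j + 1)" using dbl by simp
  show "black (rv 0 j \<circ> P) 0 = inv P (2 * j)" using br[of 0] P by simp
  show "black (rv 0 j \<circ> P) (inv P 1) = inv P (2 * j + 1)" using br[of "inv P 1"] bij by simp
  show "black (rv 0 j \<circ> P) v = black P v" if "v \<notin> {0, inv P 1, inv P (2 * j), inv P (2 * j + 1)}"
    using that br[of v] inv_P(1)[OF bij, of v] inv0 by auto
  have inj: "inv P p = inv P q \<longleftrightarrow> p = q" for p q by (metis bij inv_P(2))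
  show "distinct [0, inv P 1, inv P (2 * j), inv P (2 * j + 1)]"
    using inj[of 0] j by (auto simp: inv0 inj)
  show "inv P (2 * j) < 2 * n + 2" using adm_in[OF P, of "inv P (2 * j)"] bij j by simp
qed

lemma potential_id_le: "potential n (black id) \<le> 0"
proof -
  have sub: "orb mate mate ` {..<2 * n + 2} \<subseteq> (\<lambda>k. {2 * k, 2 * k + 1}) ` {..n}"
  proof (intro image_subsetI)
    fix v :: nat assume v: "v \<in> {..<2 * n + 2}"
    have "orb mate mate v \<subseteq> {v, mate v}" by (rule orb_subset) auto
    moreover have "mate v \<in> orb mate mate v" by (rule orb_step(1)) simp
    ultimately have "orb mate mate v = {v, mate v}" by auto
    then show "orb mate mate v \<in> (\<lambda>k. {2 * k, 2 * k + 1}) ` {..n}"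
      using v by (intro image_eqI[of _ _ "v div 2"]) (auto simp: mate_def elim!: evenE oddE)
  qed
  have "card (orb mate mate ` {..<2 * n + 2}) \<le> card ((\<lambda>k. {2 * k, 2 * k + 1}) ` {..n})"
    by (rule card_mono[OF _ sub]) simp
  also have "\<dots> \<le> card {..n}" by (rule card_image_le) simp
  finally show ?thesis by (simp add: potential_def num_orbs_def breaks_def black_id)
qed

abbreviation flips :: "nat list \<Rightarrow> (nat \<Rightarrow> nat) \<Rightarrow> nat \<Rightarrow> nat" where
  "flips \<equiv> fold (\<lambda>j P. rv 0 j \<circ> P)"

lemma length_ge_potential:
  assumes "adm n P" "set js \<subseteq> {1..n}" "flips js P = id"
  shows "potential n (black P) \<le> int (length js)"
  using assms
proof (induction js arbitrary: P)
  case Nil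
  then show ?case using potential_id_le[of n] by (simp add: id_def)
next
  case (Cons j js)
  then have j: "1 \<le> j" "j \<le> n" by auto
  interpret black_swap n "black P" "black (rv 0 j \<circ> P)" "inv P 1" "inv P (2 * j)" "inv P (2 * j + 1)"
    using Cons.prems(1) j by (rule prefix_black_swap)
  have "potential n (black (rv 0 j \<circ> P)) \<le> int (length js)"
    using Cons.prems j by (intro Cons.IH adm_rv) auto
  then show ?case using potential_cases(1) by simp
qed

section \<open>The leftmost component\<close>

definition strictly_between :: "nat \<Rightarrow> nat \<Rightarrow> nat \<Rightarrow> bool" where
  "strictly_between a c p \<longleftrightarrow> a < p \<and> p < c \<or> c < p \<and> p < a"

lemma strictly_between_xor: "p \<noteq> a \<Longrightarrow> p \<noteq> c \<Longrightarrow> strictly_between a c p \<longleftrightarrow> (a < p) \<noteq> (c < p)"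
  by (auto simp: strictly_between_def)

text \<open>Both sides are the parity of the four comparisons between {a, c} and {p, q}; this makes
  crossing symmetric.\<close>

lemma strictly_between_swap:
  assumes "p \<noteq> a" "p \<noteq> c" "q \<noteq> a" "q \<noteq> c"
  shows "(strictly_between a c p \<noteq> strictly_between a c q) \<longleftrightarrow>
    (strictly_between p q a \<noteq> strictly_between p q c)"
proof -
  have "p < a \<longleftrightarrow> \<not> a < p" "p < c \<longleftrightarrow> \<not> c < p" "q < a \<longleftrightarrow> \<not> a < q" "q < c \<longleftrightarrow> \<not> c < q"
    using assms by auto
  then show ?thesis using assms by (simp add: strictly_between_xor) blast
qed

lemma strictly_between_outside:
  "strictly_between a c r \<Longrightarrow> strictly_between a c s \<Longrightarrow> \<not> strictly_between a c p \<Longrightarrow> p < r \<longleftrightarrow> p < s"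
  unfolding strictly_between_def by linarith

lemma strictly_between_mate:
  assumes "p \<noteq> a" "p \<noteq> c" "mate p \<noteq> a" "mate p \<noteq> c"
  shows "strictly_between a c (mate p) \<longleftrightarrow> strictly_between a c p"
proof -
  have "x < mate p \<longleftrightarrow> x < p" if "p \<noteq> x" "mate p \<noteq> x" for x
    using that by (cases "even p") (auto simp: mate_def elim: oddE)
  then show ?thesis using assms by (simp add: strictly_between_xor)
qed

text \<open>Interleaving of the grey edges at \<open>u\<close> and \<open>v\<close>, in a form that
  needs no ordering of their ends; \<open>interleaving_edges_pos\<close> links it to
  supports.\<close>

definition crosses :: "(nat \<Rightarrow> nat) \<Rightarrow> nat \<Rightarrow> nat \<Rightarrow> bool" where
  "crosses P u v \<longleftrightarrow>
     strictly_between (P u) (P (mate u)) (P v) \<noteq> strictly_between (P u) (P (mate u)) (P (mate v))"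

definition oriented :: "(nat \<Rightarrow> nat) \<Rightarrow> nat \<Rightarrow> bool" where
  "oriented P v \<longleftrightarrow> even (P v) = even (P (mate v))"

text \<open>The labels on all cycles of the leftmost component. A single closure merges the two
  levels of cycles and components.\<close>

definition leftmost_labels :: "(nat \<Rightarrow> nat) \<Rightarrow> nat set" where
  "leftmost_labels P =
     ({(u, black P u) | u. True} \<union> {(u, mate u) | u. True} \<union> {(u, v). crosses P u v})\<^sup>* `` {0}"

lemma leftmost_labels_0 [simp]: "0 \<in> leftmost_labels P"
  by (auto simp: leftmost_labels_def)

lemma leftmost_labels_step:
  "u \<in> leftmost_labels P \<Longrightarrow> black P u \<in> leftmost_labels P"
  "u \<in> leftmost_labels P \<Longrightarrow> mate u \<in> leftmost_labels P"
  "u \<in> leftmost_labels P \<Longrightarrow> crosses P u v \<Longrightarrow> v \<in> leftmost_labels P"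
  unfolding leftmost_labels_def by (auto intro: rtrancl_into_rtrancl)

lemma leftmost_labels_mate_iff [simp]: "mate u \<in> leftmost_labels P \<longleftrightarrow> u \<in> leftmost_labels P"
  using leftmost_labels_step(2)[of u P] leftmost_labels_step(2)[of "mate u" P] by auto

lemma leftmost_labels_induct [consumes 1, case_names zero black mate crosses]:
  assumes "u \<in> leftmost_labels P" "Q 0"
    and "\<And>u. u \<in> leftmost_labels P \<Longrightarrow> Q u \<Longrightarrow> Q (black P u)"
    and "\<And>u. u \<in> leftmost_labels P \<Longrightarrow> Q u \<Longrightarrow> Q (mate u)"
    and "\<And>u v. u \<in> leftmost_labels P \<Longrightarrow> v \<in> leftmost_labels P \<Longrightarrow> Q u \<Longrightarrow> crosses P u v \<Longrightarrow> Q v"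
  shows "Q u"
proof -
  have "(0, u) \<in> ({(u, black P u) | u. True} \<union> {(u, mate u) | u. True} \<union> {(u, v). crosses P u v})\<^sup>*"
    using assms(1) by (auto simp: leftmost_labels_def)
  then have "u \<in> leftmost_labels P \<and> Q u"
  proof (induction rule: rtrancl_induct)
    case (step y z)
    then consider "z = black P y" | "z = mate y" | "crosses P y z" by auto
    then show ?case
      by cases (use step.IH leftmost_labels_step[of y P] assms(3-5) in metis)+
  qed (simp add: assms(2))
  then show ?thesis ..
qed

lemma inj_P_iff: "bij P \<Longrightarrow> P u = P v \<longleftrightarrow> u = v"
  by (metis inv_P(1))

lemma crosses_distinct:
  "crosses P u v \<Longrightarrow> v \<noteq> u \<and> v \<noteq> mate u \<and> mate v \<noteq> u \<and> mate v \<noteq> mate u"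
  by (auto simp: crosses_def strictly_between_def)

lemma crosses_sym:
  assumes "bij P" "crosses P u v"
  shows "crosses P v u"
proof -
  have "P v \<noteq> P u" "P v \<noteq> P (mate u)" "P (mate v) \<noteq> P u" "P (mate v) \<noteq> P (mate u)"
    using crosses_distinct[OF assms(2)] by (simp_all add: inj_P_iff[OF assms(1)])
  then show ?thesis using assms(2) strictly_between_swap unfolding crosses_def by metis
qed

text \<open>
  The leftmost component contains position 0, which lies outside every other interval, and no edge
  of the component crosses an edge outside of it.
\<close>

lemma leftmost_labels_not_nested:
  assumes P: "adm n P" and v: "v \<notin> leftmost_labels P" and u: "u \<in> leftmost_labels P"
  shows "\<not> strictly_between (P v) (P (mate v)) (P u)"
proof -
  let ?in = "strictly_between (P v) (P (mate v))" and ?K = "leftmost_labels P"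
  note bij = adm_bij[OF P]
  have mv: "mate v \<notin> ?K" using v by simp
  have ne: "P w \<noteq> P v" "P w \<noteq> P (mate v)" if "w \<in> ?K" for w
    using that v mv bij by (auto simp: inj_P_iff)
  \<comment> \<open>Otherwise the grey edge at \<open>w\<close> would cross that at \<open>v\<close>
    and pull \<open>v\<close> into the component.\<close>
  have M: "?in (P (mate w)) \<longleftrightarrow> ?in (P w)" if "w \<in> ?K" for w
    using leftmost_labels_step(3)[OF that, of v] crosses_sym[OF bij, of v w] v
    by (auto simp: crosses_def)
  have "\<not> ?in (P u) \<and> \<not> ?in (P (mate u))"
    using u
  proof (induction rule: leftmost_labels_induct)
    case zero
    have "\<not> ?in (P 0)" using P by (simp add: strictly_between_def)
    then show ?case using M[of 0] by simp
  next
    case (black u)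
    have b: "black P u \<in> ?K" using black leftmost_labels_step by blast
    have eq: "P (black P u) = mate (P u)" using bij by simp
    have "\<not> ?in (P (black P u))"
      using black ne[OF black(1)] ne[OF b] strictly_between_mate unfolding eq by metis
    then show ?case using M[OF b] by simp
  next
    case (mate u)
    then show ?case by simp
  next
    case (crosses u w)
    have ne': "P w \<noteq> P u" "P w \<noteq> P (mate u)" "P (mate w) \<noteq> P u" "P (mate w) \<noteq> P (mate u)"
      using crosses_distinct[OF crosses(3)] by (simp_all add: inj_P_iff[OF bij])
    \<comment> \<open>An edge inside the interval cannot cross the edge at \<open>u\<close>, both of
      whose ends lie outside.\<close>
    have "\<not> (?in (P w) \<and> ?in (P (mate w)))"
    proof
      assume w: "?in (P w) \<and> ?in (P (mate w))"
      have "P u < P w \<longleftrightarrow> P u < P (mate w)" "P (mate u) < P w \<longleftrightarrow> P (mate u) < P (mate w)"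
        using w crosses(4) strictly_between_outside by blast+
      then show False using crosses(3) ne' by (simp add: crosses_def strictly_between_xor)
    qed
    then show ?case using M[OF crosses(2)] by simp
  qed
  then show ?thesis ..
qed

text \<open>
  Every other component sits in one gap between consecutive vertices of the leftmost one. Hence
  replacing black edges by grey ones permutes the gaps, but each of them is still traversed from
  left to right.
\<close>

lemma parity_preserved:
  assumes P: "adm n P" and Q: "adm n Q"
    and nonor: "\<And>v. v \<in> leftmost_labels P \<Longrightarrow> \<not> oriented P v"
    and blk: "\<And>v. black Q v \<in> {black P v, mate v}"
    and K: "u \<in> leftmost_labels P"
  shows "even (P u) \<longleftrightarrow> even (Q u)"
  using K
\<comment> \<open>The induction scans the labels in the order of the new arrangement
  \<open>Q\<close>, from left to right.\<close>
proof (induction "Q u" arbitrary: u rule: less_induct)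
  case less
  let ?K = "leftmost_labels P"
  note bijP = adm_bij[OF P] and bijQ = adm_bij[OF Q]
  \<comment> \<open>An original black edge always changes the parity of the position, a grey one
    does so because it is nonoriented.\<close>
  have flip: "even (P (black Q w)) \<longleftrightarrow> odd (P w)" "black Q w \<in> ?K" if "w \<in> ?K" for w
  proof -
    have "even (P (mate w)) \<longleftrightarrow> odd (P w)" using nonor[OF that] by (auto simp: oriented_def)
    moreover have "even (P (black P w)) \<longleftrightarrow> odd (P w)" using bijP by simp
    ultimately show "even (P (black Q w)) \<longleftrightarrow> odd (P w)" using blk[of w] by auto
    show "black Q w \<in> ?K" using blk[of w] leftmost_labels_step[OF that] that by auto
  qed
  consider "Q u = 0" | i where "Q u = Suc (2 * i)" | i where "Q u = Suc (Suc (2 * i))"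
    by (rule elem_cases)
  then show ?case
  proof cases
    case 1
    then have "u = 0" using inj_P_iff[OF bijQ, of u 0] Q by simp
    then show ?thesis using P Q by simp
  next
    case 2
    have "Q (black Q u) = 2 * i" using 2 bijQ by simp
    with less.hyps[of "black Q u"] flip[OF less.prems] 2 show ?thesis by simp
  next
    case 3
    \<comment> \<open>Its maximum yields \<open>l\<close>, the last label of the component at an odd
      position before \<open>u\<close> in \<open>Q\<close>. The stretch between \<open>l\<close> and
      \<open>u\<close> then holds only foreign labels.\<close>
    define R where "R = {m. m \<le> i \<and> inv Q (Suc (2 * m)) \<in> ?K}"
    have "inv Q 1 = black Q 0" using bijQ Q by (simp add: black_def)
    then have "0 \<in> R" using flip(2)[of 0] by (simp add: R_def)
    then have R: "finite R" "R \<noteq> {}" by (auto simp: R_def)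
    define m where "m = Max R"
    have m: "m \<in> R" and max: "\<And>m'. m' \<in> R \<Longrightarrow> m' \<le> m" using R by (auto simp: m_def)
    define l where "l = inv Q (Suc (2 * m))"
    have l: "l \<in> ?K" "Q l = Suc (2 * m)" "m \<le> i" using m bijQ by (auto simp: l_def R_def)
    have odd_l: "odd (P l)" using less.hyps[of l] l 3 by simp
    have el: "Q (elem_mate w) = elem_mate (Q w)" "P (elem_mate w) = elem_mate (P w)" for w
      using P Q by (auto simp: adm_def)
    \<comment> \<open>The gap of \<open>P\<close> to the right of \<open>l\<close>. Even positions
      suffice as bounds: a component label at an odd position beyond \<open>l\<close> has its black
      partner just before it. The bound is weak since the walk ends at \<open>u\<close>, itself the
      right end of the gap.\<close>
    define gap where "gap w \<longleftrightarrow> P l < P w \<and> (\<forall>k \<in> ?K. even (P k) \<and> P l < P k \<longrightarrow> P w \<le> P k)" for w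
    have notK: "inv Q q \<notin> ?K" if "Suc (2 * m) < q" "q < Suc (Suc (2 * i))" for q
    proof
      assume k: "inv Q q \<in> ?K"
      show False
      proof (cases "even q")
        case True
        then have q: "Suc q = Suc (2 * (q div 2))" by simp
        have "inv Q (Suc q) = black Q (inv Q q)" using True bijQ by (simp add: black_def mate_def)
        then have "inv Q (Suc (2 * (q div 2))) \<in> ?K" using flip(2)[OF k] q by simp
        moreover have "q div 2 \<le> i" "m < q div 2" using that True by auto
        ultimately show False using max[of "q div 2"] by (auto simp: R_def)
      next
        case False
        then have q: "q = Suc (2 * (q div 2))" by simp
        then have "q div 2 \<in> R" using that k by (simp add: R_def)
        then show False using max[of "q div 2"] that by linarith
      qed
    qed
    have gap: "gap (inv Q q)" if "Suc (Suc (2 * m)) \<le> q" "q \<le> Suc (Suc (2 * i))" for q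
      using that
    proof (induction q rule: dec_induct)
      case base
      have "Q (elem_mate l) = Suc (Suc (2 * m))" by (simp add: el l(2))
      then have "inv Q (Suc (Suc (2 * m))) = elem_mate l" using bijQ by (metis inv_P(1))
      moreover have "P (elem_mate l) = Suc (P l)" using odd_l by (simp add: el elem_mate_def[of "P l"] odd_pos)
      ultimately show ?case by (auto simp: gap_def)
    next
      case (step q)
      define w where "w = inv Q q"
      have w: "w \<notin> ?K" "gap w" "Q w = q" using notK[of q] step bijQ by (auto simp: w_def)
      have ne: "P w \<noteq> P k" "P (mate w) \<noteq> P k" if "k \<in> ?K" for k using that w(1) bijP by (auto simp: inj_P_iff)
      show ?case
      proof (cases "even q")
        case True
        then have nx: "inv Q (Suc q) = black Q w" using bijQ by (simp add: black_def mate_def w(3))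
        \<comment> \<open>A black edge joins 2i and 2i+1, so it jumps neither over the odd position
          of \<open>l\<close> nor over an even bound; a grey edge of another component encloses no
          label of this one.\<close>
        consider "black Q w = black P w" | "black Q w = mate w" using blk[of w] by auto
        then have "gap (black Q w)"
        proof cases
          case 1
          have eq: "P (black P w) = mate (P w)" using bijP by simp
          show ?thesis unfolding gap_def 1 eq
          proof (intro conjI ballI impI)
            show "P l < mate (P w)"
              using w(2) odd_l by (auto simp: gap_def mate_def) presburger
            fix k assume k: "k \<in> ?K" "even (P k) \<and> P l < P k"
            then have "P w < P k" using w(2) ne[OF k(1)] by (auto simp: gap_def order_less_le)
            then show "mate (P w) \<le> P k" using k(2) by (auto simp: mate_def)
          qed
        next
          case 2
          have nest: "\<not> strictly_between (P w) (P (mate w)) (P k)" if "k \<in> ?K" for k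
            using leftmost_labels_not_nested[OF P w(1) that] .
          show ?thesis unfolding gap_def 2
          proof (intro conjI ballI impI)
            show "P l < P (mate w)"
              using nest[OF l(1)] w(2) ne[OF l(1)] by (auto simp: gap_def strictly_between_def)
            fix k assume k: "k \<in> ?K" "even (P k) \<and> P l < P k"
            then have "P w < P k" using w(2) ne[OF k(1)] by (auto simp: gap_def order_less_le)
            then show "P (mate w) \<le> P k"
              using nest[OF k(1)] by (auto simp: strictly_between_def)
          qed
        qed
        with nx show ?thesis by simp
      next
        case False
        have "Q (elem_mate w) = Suc q" using False w(3) by (simp add: el elem_mate_def[of q] odd_pos)
        then have nx: "inv Q (Suc q) = elem_mate w" using bijQ by (metis inv_P(1))
        have "elem_mate w \<noteq> l"
          using \<open>Q (elem_mate w) = Suc q\<close> l(2) step.hyps by auto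
        then have ne_l: "P (elem_mate w) \<noteq> P l" using bijP by (simp add: inj_P_iff)
        have "gap (elem_mate w)" unfolding gap_def
        proof (intro conjI ballI impI)
          show "P l < P (elem_mate w)"
            using w(2) ne_l unfolding el by (auto simp: gap_def elem_mate_def split: if_splits)
          fix k assume k: "k \<in> ?K" "even (P k) \<and> P l < P k"
          then have "P w < P k" using w(2) ne[OF k(1)] by (auto simp: gap_def order_less_le)
          then show "P (elem_mate w) \<le> P k" unfolding el by (auto simp: elem_mate_def)
        qed
        with nx show ?thesis by simp
      qed
    qed
    have "gap u" using gap[of "Q u"] 3 l(3) inv_P(1)[OF bijQ, of u] by simp
    \<comment> \<open>At an odd position, \<open>u\<close> would have its black partner, also in the
      component, directly to its left and still inside the gap.\<close>
    have "even (P u)"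
    proof (rule ccontr)
      assume odd: "odd (P u)"
      have pos: "P (black P u) = P u - 1" using odd bijP by (simp add: mate_def)
      have "even (P (black P u))" "P l < P (black P u)" "black P u \<in> ?K"
        using odd odd_l \<open>gap u\<close> leftmost_labels_step(1)[OF less.prems] unfolding pos
        by (auto simp: gap_def elim!: oddE)
      then have "P u \<le> P (black P u)" using \<open>gap u\<close> by (auto simp: gap_def)
      then show False using pos odd by (auto elim: oddE)
    qed
    then show ?thesis using 3 by simp
  qed
qed

section \<open>The lower bound\<close>

text \<open>
  States reached from \<open>P\<^sub>0\<close> by flips that all lower the potential, as long as the first vertex of the
  original leftmost cycle has not been split off: the original leftmost cycle is still the tail of
  the current one, and outside of the current one every black edge is original or already grey.
\<close>

definition shadows :: "(nat \<Rightarrow> nat) \<Rightarrow> (nat \<Rightarrow> nat) \<Rightarrow> bool" where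
  "shadows P\<^sub>0 P \<longleftrightarrow>
     (\<forall>v \<in> orb (black P\<^sub>0) mate 0 - {0, black P\<^sub>0 0}. black P v = black P\<^sub>0 v) \<and>
     (\<forall>v. v \<notin> orb (black P) mate 0 \<longrightarrow> black P v \<in> {black P\<^sub>0 v, mate v})"

text \<open>The first black edge, at 0, need not be checked for closure: it would be the only one
  leaving \<open>S\<close>, which parity forbids.\<close>

lemma orb_black_subset:
  assumes P: "adm n P" and S: "0 \<in> S" "\<And>v. v \<in> S \<Longrightarrow> mate v \<in> S"
    and b: "\<And>v. v \<in> S \<Longrightarrow> v \<noteq> 0 \<Longrightarrow> v \<noteq> black P 0 \<Longrightarrow> black P v \<in> S"
  shows "orb (black P) mate 0 \<subseteq> S"
proof -
  note bij = adm_bij[OF P]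
  have "black P 0 \<in> S"
  proof (rule ccontr)
    assume n: "black P 0 \<notin> S"
    let ?A = "S \<inter> {..<2 * n + 2}"
    have "black P 0 \<in> ?A"
    proof (rule black_mem_of_parity[OF bij])
      fix v assume "v \<in> ?A"
      then show "mate v \<in> ?A" using S(2) mate_less_iff[of v n] by simp
    next
      fix v assume v: "v \<in> ?A" "v \<noteq> 0"
      moreover have "v \<noteq> black P 0" using v n by auto
      ultimately show "black P v \<in> ?A" using b black_in[OF P, of v] by simp
    qed (use S(1) in auto)
    then show False using n by auto
  qed
  then have "black P v \<in> S" if "v \<in> S" for v
    using b[OF that] black_black[OF bij, of 0] S(1) by (cases "v = 0"; cases "v = black P 0") auto
  then show ?thesis by (intro orb_subset S)
qed

lemma shadows_refl: "shadows P P"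
  by (auto simp: shadows_def)

lemma shadows_orb_subset:
  assumes P0: "adm n P\<^sub>0" and sh: "shadows P\<^sub>0 P"
  shows "orb (black P\<^sub>0) mate 0 \<subseteq> orb (black P) mate 0"
proof -
  let ?S = "orb (black P\<^sub>0) mate 0 \<inter> orb (black P) mate 0"
  have "orb (black P\<^sub>0) mate 0 \<subseteq> ?S"
  proof (rule orb_black_subset[OF P0])
    fix v assume v: "v \<in> ?S"
    then show "mate v \<in> ?S" using orb_step(2) by fast
    assume "v \<noteq> 0" "v \<noteq> black P\<^sub>0 0"
    then have "black P v = black P\<^sub>0 v" using sh v by (auto simp: shadows_def)
    then show "black P\<^sub>0 v \<in> ?S"
      using v orb_step(1)[of v "black P" mate 0] orb_step(1)[of v "black P\<^sub>0" mate 0] by simp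
  qed simp
  then show ?thesis by auto
qed

text \<open>Three ways to lower the potential: absorb a nontrivial cycle, split off a label stacked
  on top, or split off the original first vertex. The last is ruled out by
  \<open>parity_preserved\<close>.\<close>

lemma shadows_flip:
  assumes P0: "adm n P\<^sub>0" and nonor: "\<And>v. v \<in> leftmost_labels P\<^sub>0 \<Longrightarrow> \<not> oriented P\<^sub>0 v"
    and P: "adm n P" and sh: "shadows P\<^sub>0 P" and j: "1 \<le> j" "j \<le> n"
    and less: "potential n (black (rv 0 j \<circ> P)) < potential n (black P)"
  shows "shadows P\<^sub>0 (rv 0 j \<circ> P)"
proof -
  define b b' b0 x y z where defs: "b = black P" "b' = black (rv 0 j \<circ> P)" "b0 = black P\<^sub>0"
    "x = inv P 1" "y = inv P (2 * j)" "z = inv P (2 * j + 1)"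
  interpret black_swap n b b' x y z
    unfolding defs using P j by (rule prefix_black_swap)
  note bij0 = adm_bij[OF P0] and bij = adm_bij[OF P]
  have inv_b0: "b0 (b0 v) = v" for v using bij0 by (simp add: defs)
  let ?V0 = "orb b0 mate 0"
  have tail: "b v = b0 v" if "v \<in> ?V0" "v \<noteq> 0" "v \<noteq> b0 0" for v
    using sh that by (auto simp: shadows_def defs)
  have rest: "b v \<in> {b0 v, mate v}" if "v \<notin> orb b mate 0" for v
    using sh that by (auto simp: shadows_def defs)
  have V0: "?V0 \<subseteq> orb b mate 0" using shadows_orb_subset[OF P0 sh] by (simp add: defs)
  have V0_step: "b0 v \<in> ?V0" "mate v \<in> ?V0" if "v \<in> ?V0" for v
    using that orb_step(1)[of v b0 mate 0] orb_step(2)[of v b0 mate 0] by auto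
  \<comment> \<open>The current first vertex is either stacked on top or the original first one: any
    other tail vertex keeps its original partner, which is not 0.\<close>
  have x_tail: "x = b0 0" if "x \<in> ?V0"
  proof (rule ccontr)
    assume "x \<noteq> b0 0"
    then have "b x = b0 x" using tail[OF that] dist by simp
    then show False using old' inv_b0[of x] \<open>x \<noteq> b0 0\<close> by simp
  qed
  have "potential n b' < potential n b" using less by (simp add: defs)
  from potential_cases(2)[OF this] consider "y \<notin> orb b mate 0" "mate y \<noteq> z" | "mate x = z" "x \<noteq> b0 0" | "mate x = z" "x = b0 0"
    by blast
  then have goal: "(\<forall>v \<in> ?V0 - {0, b0 0}. b' v = b0 v) \<and> (\<forall>v. v \<notin> orb b' mate 0 \<longrightarrow> b' v \<in> {b0 v, mate v})"
  proof cases
    case 1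
    have z: "z \<notin> orb b mate 0"
      using 1 orb_step(1)[of z b mate 0] old' by auto
    let ?S = "orb b' mate 0"
    \<comment> \<open>The new cycle runs from 0 to \<open>y\<close> and through the absorbed cycle.
      Were it to miss \<open>x\<close>, it would miss \<open>z\<close>, and inside the old cycle of
      \<open>y\<close> only the edge y-z would leave it, against parity.\<close>
    have xz: "x \<in> ?S"
    proof (rule ccontr)
      assume x: "x \<notin> ?S"
      then have "z \<notin> ?S" using orb_step(1)[of z b' mate 0] new' by auto
      let ?A = "?S \<inter> orb b mate y \<inter> {..<2 * n + 2}"
      have no: "v \<noteq> 0 \<and> v \<noteq> x" if "v \<in> orb b mate y" for v
      proof -
        have "0 \<notin> orb b mate y" using 1(1) orb_sym[of b mate 0 y] inv_b by auto
        moreover have "x \<in> orb b mate y \<Longrightarrow> 0 \<in> orb b mate y"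
          using orb_step(1)[of x b mate y] old' by simp
        ultimately show ?thesis using that by metis
      qed
      have "b y \<in> ?A"
        unfolding defs(1)
      proof (rule black_mem_of_parity[OF bij])
        show "finite (orb b' mate 0 \<inter> orb (black P) mate y \<inter> {..<2 * n + 2})" by simp
        show "y \<in> orb b' mate 0 \<inter> orb (black P) mate y \<inter> {..<2 * n + 2}"
          using y_V orb_step(1)[of 0 b' mate 0] new by simp
        fix v assume v: "v \<in> orb b' mate 0 \<inter> orb (black P) mate y \<inter> {..<2 * n + 2}"
        then show "mate v \<in> orb b' mate 0 \<inter> orb (black P) mate y \<inter> {..<2 * n + 2}"
          using orb_step(2)[of v b' mate 0] orb_step(2)[of v "black P" mate y] mate_less_iff[of v n] by simp
        assume "v \<noteq> y"
        then have "b' v = black P v"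
          using other[of v] no[of v] v \<open>z \<notin> ?S\<close> by (auto simp: defs(1))
        then show "black P v \<in> orb b' mate 0 \<inter> orb (black P) mate y \<inter> {..<2 * n + 2}"
          using v orb_step(1)[of v b' mate 0] orb_step(1)[of v "black P" mate y] black_in[OF P, of v] by simp
      qed
      then show False using old \<open>z \<notin> ?S\<close> by simp
    qed
    have mem: "x \<in> ?S" "y \<in> ?S" "z \<in> ?S"
      using xz orb_step(1)[of 0 b' mate 0] orb_step(1)[of x b' mate 0] new by auto
    have sub: "orb b mate 0 \<subseteq> ?S"
    proof (rule orb_subset)
      fix v assume v: "v \<in> ?S"
      then show "mate v \<in> ?S" by (rule orb_step(2))
      show "b v \<in> ?S"
      proof (cases "v \<in> {0, x, y, z}")
        case True
        then show ?thesis using mem old old' orb_self[of 0 b' mate] by auto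
      next
        case False
        then show ?thesis using other[OF False] orb_step(1)[OF v] by simp
      qed
    qed simp
    show ?thesis
    proof (intro conjI ballI allI impI)
      fix v assume v: "v \<in> ?V0 - {0, b0 0}"
      then have "v \<notin> {0, x, y, z}" using V0 1(1) z x_tail by auto
      then show "b' v = b0 v" using other tail v by auto
    next
      fix v assume v: "v \<notin> ?S"
      then have "v \<notin> {0, x, y, z}" using mem orb_self[of 0 b' mate] by blast
      then show "b' v \<in> {b0 v, mate v}" using other rest[of v] sub v by auto
    qed
  next
    case 2
    have x: "x \<notin> ?V0" using x_tail 2 by auto
    then have z: "z \<notin> ?V0" using V0_step(2)[of z] 2(1) by auto
    let ?S = "orb b' mate 0 \<union> {x, z}"
    have y: "y \<in> orb b' mate 0" using orb_step(1)[of 0 b' mate 0] new by simp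
    have sub: "orb b mate 0 \<subseteq> ?S"
    proof (rule orb_subset)
      fix v assume v: "v \<in> ?S"
      then show "mate v \<in> ?S" using orb_step(2)[of v b' mate 0] 2(1) by auto
      show "b v \<in> ?S"
      proof (cases "v \<in> {0, x, y, z}")
        case True
        then show ?thesis using y old old' orb_self[of 0 b' mate] by auto
      next
        case False
        then show ?thesis using other[OF False] orb_step(1)[of v b' mate 0] v by auto
      qed
    qed simp
    show ?thesis
    proof (intro conjI ballI allI impI)
      fix v assume v: "v \<in> ?V0 - {0, b0 0}"
      have "v \<noteq> y" using v tail[of v] V0_step(1)[of v] old z by auto
      then have "v \<notin> {0, x, y, z}" using v x z by auto
      then show "b' v = b0 v" using other tail v by auto
    next
      fix v assume v: "v \<notin> orb b' mate 0"
      show "b' v \<in> {b0 v, mate v}"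
      proof (cases "v = x \<or> v = z")
        case True
        then show ?thesis using 2(1) new new' by auto
      next
        case False
        then have "v \<notin> {0, x, y, z}" using v y orb_self[of 0 b' mate] by blast
        then show ?thesis using other rest[of v] sub v False by auto
      qed
    qed
  next
    case 3
    have bx: "b 0 = b0 0" "b x = b0 x" using 3 old old' inv_b0[of 0] by auto
    have V0_b: "b v = b0 v" if "v \<in> ?V0" for v
      using tail[OF that] bx 3 by (cases "v = 0"; cases "v = x") auto
    have "orb b mate 0 \<subseteq> ?V0"
      by (rule orb_subset) (use V0_b V0_step in auto)
    then have blk: "black P v \<in> {black P\<^sub>0 v, mate v}" for v
      using V0_b[of v] rest[of v] unfolding defs by blast
    have "x \<in> leftmost_labels P\<^sub>0"
      using 3 leftmost_labels_step(1)[of 0 P\<^sub>0] by (simp add: defs)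
    then have K: "x \<in> leftmost_labels P\<^sub>0" "z \<in> leftmost_labels P\<^sub>0" using 3(1) leftmost_labels_step(2)[of x] by auto
    \<comment> \<open>Both positions are odd; parity carries this back to \<open>P\<^sub>0\<close>,
      where it would make the grey edge x-z oriented.\<close>
    have "P x = 1" "P z = 2 * j + 1" using bij by (simp_all add: defs)
    then have "odd (P\<^sub>0 x)" "odd (P\<^sub>0 z)"
      using parity_preserved[OF P0 P nonor blk] K by auto
    then show ?thesis using nonor[OF K(1)] 3(1) by (auto simp: oriented_def)
  qed
  then show ?thesis unfolding shadows_def defs .
qed

lemma length_gt_potential:
  assumes P0: "adm n P\<^sub>0" and nonor: "\<And>v. v \<in> leftmost_labels P\<^sub>0 \<Longrightarrow> \<not> oriented P\<^sub>0 v"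
    and P01: "P\<^sub>0 1 \<noteq> 1"
    and "adm n P" "shadows P\<^sub>0 P" "set js \<subseteq> {1..n}" "flips js P = id"
  shows "potential n (black P) < int (length js)"
  using assms(4-)
proof (induction js arbitrary: P)
  case Nil
  then have P: "P = id" by (simp add: id_def)
  \<comment> \<open>The identity shadows nothing of this kind: label 1, the last on the original
    cycle, still has its original partner, which is not 0.\<close>
  let ?V0 = "orb (black P\<^sub>0) mate 0"
  have bij0: "bij P\<^sub>0" using P0 by (rule adm_bij)
  have "1 \<in> ?V0" using orb_step(2)[of 0 "black P\<^sub>0" mate 0] by simp
  moreover have "1 \<noteq> black P\<^sub>0 0"
    using P01 P_black[OF bij0, of 0] P0 by auto
  moreover then have "black P\<^sub>0 1 \<noteq> 0" using black_black[OF bij0, of 1] by metis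
  ultimately have "black P 1 = black P\<^sub>0 1" "black P\<^sub>0 1 \<noteq> 0" using Nil(2) by (auto simp: shadows_def)
  moreover have "black P 1 = 0" by (simp add: P black_id)
  ultimately show ?case by simp
next
  case (Cons j js)
  let ?P = "rv 0 j \<circ> P"
  have j: "1 \<le> j" "j \<le> n" using Cons.prems by auto
  have P': "adm n ?P" using Cons.prems(1) j by (intro adm_rv)
  have js: "set js \<subseteq> {1..n}" "flips js ?P = id"
    using Cons.prems(3,4) by (auto simp only: fold_simps list.set)
  interpret black_swap n "black P" "black ?P" "inv P 1" "inv P (2 * j)" "inv P (2 * j + 1)"
    using Cons.prems(1) j by (rule prefix_black_swap)
  show ?case
  proof (cases "potential n (black ?P) < potential n (black P)")
    case True
    then have "shadows P\<^sub>0 ?P" using P0 nonor Cons.prems(1,2) j by (intro shadows_flip)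
    then have "potential n (black ?P) < int (length js)" by (intro Cons.IH P' js)
    with potential_cases(1) show ?thesis by simp
  next
    \<comment> \<open>This flip is the additional step; the plain bound covers the rest.\<close>
    case False
    with length_ge_potential[OF P' js] show ?thesis by simp
  qed
qed

section \<open>Removing cycles of length two\<close>

text \<open>Simplicity as an equation: the two involutions commute exactly when every alternating
  cycle closes after at most two black edges.\<close>

definition black_commutes :: "(nat \<Rightarrow> nat) \<Rightarrow> bool" where
  "black_commutes P \<longleftrightarrow> (\<forall>v. black P (mate v) = mate (black P v))"

definition nontrivial :: "(nat \<Rightarrow> nat) \<Rightarrow> nat set" where
  "nontrivial P = {v. black P v \<noteq> mate v}"

definition cyc :: "(nat \<Rightarrow> nat) \<Rightarrow> nat \<Rightarrow> nat set" where
  "cyc P v = {v, mate v, black P v, mate (black P v)}"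

lemma nontrivial_subset:
  assumes P: "adm n P"
  shows "nontrivial P \<subseteq> {..<2 * n + 2}"
proof
  fix v assume v: "v \<in> nontrivial P"
  show "v \<in> {..<2 * n + 2}"
  proof (rule ccontr)
    assume "v \<notin> {..<2 * n + 2}"
    then have "\<not> v < 2 * n + 2" "\<not> mate v < 2 * n + 2" using mate_less_iff[of v n] by auto
    then have "2 * n + 2 \<le> v" "2 * n + 2 \<le> mate v" by (simp_all only: not_less)
    then have "black P v = mate v"
      using adm_outside[OF P, of v] adm_outside[OF P, of "mate v"] by (simp add: black_eq_iff[OF adm_bij[OF P]])
    then show False using v by (simp add: nontrivial_def)
  qed
qed

lemma finite_nontrivial: "adm n P \<Longrightarrow> finite (nontrivial P)"
  using nontrivial_subset finite_subset by blast

lemma adm_1_iff: "adm n P \<Longrightarrow> P 1 = 1 \<longleftrightarrow> black P 0 = 1"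
  by (simp add: black_eq_iff adm_bij)

lemma commutes: "black_commutes P \<Longrightarrow> black P (mate v) = mate (black P v)"
  by (simp add: black_commutes_def)

lemma cyc_eq:
  assumes "bij P" "black_commutes P" "w \<in> cyc P v"
  shows "cyc P w = cyc P v"
  using assms by (auto simp: cyc_def commutes)

lemma cyc_sym: "bij P \<Longrightarrow> black_commutes P \<Longrightarrow> w \<in> cyc P v \<longleftrightarrow> v \<in> cyc P w"
  by (metis cyc_eq cyc_def insertI1)

lemma oriented_nontrivial: "bij P \<Longrightarrow> oriented P v \<Longrightarrow> black P v \<noteq> mate v"
  by (auto simp: oriented_def black_eq_iff)

lemma oriented_cyc:
  assumes "bij P" "black_commutes P" "w \<in> cyc P v"
  shows "oriented P w \<longleftrightarrow> oriented P v"
  using assms by (auto simp: cyc_def oriented_def simp flip: commutes)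

lemma strictly_between_comm: "strictly_between a c p \<longleftrightarrow> strictly_between c a p"
  by (auto simp: strictly_between_def)

lemma strictly_between_mate_left:
  assumes "p \<notin> {a, c, mate a, mate c}"
  shows "strictly_between (mate a) (mate c) p \<longleftrightarrow> strictly_between a c p"
proof -
  have "mate x < p \<longleftrightarrow> x < p" if "p \<noteq> x" "p \<noteq> mate x" for x
    using that by (cases "even x") (auto simp: mate_def elim: oddE)
  then show ?thesis using assms by (auto simp: strictly_between_xor)
qed

text \<open>The two grey edges of a cycle of length two have ends at neighbouring positions, so no
  foreign edge can tell them apart.\<close>

lemma crosses_cyc:
  assumes bij: "bij P" and com: "black_commutes P" and u: "u' \<in> cyc P u" and v: "v \<notin> cyc P u"
  shows "crosses P u' v \<longleftrightarrow> crosses P u v"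
proof -
  have m: "crosses P (mate w) v \<longleftrightarrow> crosses P w v" for w
    by (simp add: crosses_def strictly_between_comm)
  have mv: "mate v \<notin> cyc P u" using v by (auto simp: cyc_def mate_eq_swap)
  have eq: "P (black P u) = mate (P u)" "P (mate (black P u)) = mate (P (mate u))"
    using bij by (simp_all flip: commutes[OF com])
  have "P w \<notin> {P u, P (mate u), mate (P u), mate (P (mate u))}" if "w \<notin> cyc P u" for w
    using that unfolding eq[symmetric] by (simp add: cyc_def inj_P_iff[OF bij])
  then have b: "crosses P (black P u) v \<longleftrightarrow> crosses P u v"
    using v mv unfolding crosses_def eq by (simp add: strictly_between_mate_left)
  show ?thesis using u m b by (auto simp: cyc_def)
qed

lemma strictly_between_rv:
  assumes "2 * k + 1 \<le> a \<and> a \<le> 2 * l \<longleftrightarrow> 2 * k + 1 \<le> c \<and> c \<le> 2 * l"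
  shows "strictly_between (rv k l a) (rv k l c) (rv k l p) \<longleftrightarrow> strictly_between a c p"
proof (cases "2 * k + 1 \<le> a \<and> a \<le> 2 * l")
  case True
  with assms show ?thesis by (auto simp: rv_def strictly_between_def)
next
  case False
  have out: "x < rv k l p \<longleftrightarrow> x < p" "rv k l p < x \<longleftrightarrow> p < x" "rv k l x = x"
    if "\<not> (2 * k + 1 \<le> x \<and> x \<le> 2 * l)" for x
    using that by (auto simp: rv_def)
  have c: "\<not> (2 * k + 1 \<le> c \<and> c \<le> 2 * l)" using False assms by blast
  show ?thesis unfolding strictly_between_def out[OF False] out[OF c] ..
qed

text \<open>Parity changes exactly inside the block, so a grey edge changes its orientation when one
  of its ends is inside.\<close>

lemma oriented_rv:
  "oriented (rv k l \<circ> P) v \<longleftrightarrow> (oriented P v \<longleftrightarrow>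
     (2 * k + 1 \<le> P v \<and> P v \<le> 2 * l \<longleftrightarrow> 2 * k + 1 \<le> P (mate v) \<and> P (mate v) \<le> 2 * l))"
  unfolding oriented_def comp_apply even_rv by auto

text \<open>A nonempty block consists of whole elements. Were it also closed under grey edges,
  \<open>mate\<close> and \<open>elem_mate\<close> in turn would lead from any label in it down to
  label 0, which is outside.\<close>

lemma ex_crossing:
  assumes P: "adm n P" and kl: "k < l" "l \<le> n"
  shows "\<exists>u. (2 * k + 1 \<le> P u \<and> P u \<le> 2 * l) \<noteq> (2 * k + 1 \<le> P (mate u) \<and> P (mate u) \<le> 2 * l)"
proof (rule ccontr)
  assume "\<not> ?thesis"
  then have m: "2 * k + 1 \<le> P (mate u) \<and> P (mate u) \<le> 2 * l" if "2 * k + 1 \<le> P u \<and> P u \<le> 2 * l" for u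
    using that by blast
  have e: "2 * k + 1 \<le> P (elem_mate u) \<and> P (elem_mate u) \<le> 2 * l" if "2 * k + 1 \<le> P u \<and> P u \<le> 2 * l" for u
  proof -
    have "P (elem_mate u) = elem_mate (P u)" using P unfolding adm_def by blast
    then show ?thesis using that by (cases "P u" rule: elem_cases) (auto; presburger)+
  qed
  have "\<not> (2 * k + 1 \<le> P u \<and> P u \<le> 2 * l)" for u
  proof (induction u rule: less_induct)
    case (less u)
    show ?case
    proof (cases u rule: elem_cases)
      case 1
      then show ?thesis using P by simp
    next
      case (2 i)
      then show ?thesis using less[of "2 * i"] m[of u] by auto
    next
      case (3 i)
      then show ?thesis using less[of "Suc (2 * i)"] e[of u] by auto
    qed
  qed
  moreover have "P (inv P (2 * l)) = 2 * l" using adm_bij[OF P] by simp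
  moreover have "2 * k + 1 \<le> 2 * l" using kl by simp
  ultimately show False by (metis le_refl)
qed

text \<open>\<open>P\<close> commutes with \<open>mate\<close> and \<open>elem_mate\<close>, which
  in turn lead from 0 through 1, 2, 3, ...\<close>

lemma eq_id_of_trivial:
  assumes P: "adm n P" and triv: "nontrivial P = {}"
  shows "P = id"
proof
  fix v
  show "P v = id v"
  proof (induction v rule: less_induct)
    case (less v)
    have m: "P (mate u) = mate (P u)" for u
      using triv P_black[OF adm_bij[OF P], of u] by (auto simp: nontrivial_def)
    have e: "P (elem_mate u) = elem_mate (P u)" for u using P unfolding adm_def by blast
    show ?case
    proof (cases v rule: elem_cases)
      case 1
      then show ?thesis using P by simp
    next
      case (2 i)
      then show ?thesis using less[of "2 * i"] m[of "2 * i"] by simp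
    next
      case (3 i)
      then show ?thesis using less[of "Suc (2 * i)"] e[of "Suc (2 * i)"] by simp
    qed
  qed
qed

text \<open>Of the two grey edges, one has both ends at even positions. The black edges of the cycle
  then leave to the right from 2k and 2l: exactly the two that \<open>rv k l\<close>
  exchanges.\<close>

lemma oriented_position:
  assumes bij: "bij P" and com: "black_commutes P" and or: "oriented P v"
  obtains u k l where "u \<in> cyc P v" "k < l" "P u = 2 * k" "P (mate u) = 2 * l"
    "P (black P u) = 2 * k + 1" "P (mate (black P u)) = 2 * l + 1"
proof -
  define w where "w = (if even (P v) then v else black P v)"
  have w: "w \<in> cyc P v" "even (P w)" using bij by (auto simp: w_def cyc_def)
  then have "even (P (mate w))" using oriented_cyc[OF bij com w(1)] or by (simp add: oriented_def)
  define u where "u = (if P w < P (mate w) then w else mate w)"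
  have ne: "P w \<noteq> P (mate w)" using bij by (simp add: inj_P_iff)
  have u: "u \<in> cyc P v" "P u < P (mate u)" "even (P u)" "even (P (mate u))"
    using w \<open>even (P (mate w))\<close> ne cyc_eq[OF bij com w(1)] by (auto simp: u_def cyc_def)
  show ?thesis
  proof (rule that[OF u(1), of "P u div 2" "P (mate u) div 2"])
    show "P u div 2 < P (mate u) div 2" using u(2-4) by (auto elim!: evenE)
    show "P (black P u) = 2 * (P u div 2) + 1" using u(3) bij by (simp add: mate_def)
    have "P (mate (black P u)) = mate (P (mate u))" using bij by (simp flip: commutes[OF com])
    then show "P (mate (black P u)) = 2 * (P (mate u) div 2) + 1" using u(4) by (simp add: mate_def)
  qed (use u in auto)
qed

lemma remove_oriented:
  assumes P: "adm n P" and com: "black_commutes P" and kl: "k < l"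
    and u: "P u = 2 * k" "P (mate u) = 2 * l" "P (black P u) = 2 * k + 1" "P (mate (black P u)) = 2 * l + 1"
  defines "P' \<equiv> rv k l \<circ> P"
  shows "black P' v = (if v \<in> cyc P u then mate v else black P v)"
    and "black_commutes P'" and "card (nontrivial P') + 4 = card (nontrivial P)"
proof -
  note bij = adm_bij[OF P]
  have inv: "inv P (2 * k) = u" "inv P (2 * l) = mate u" "inv P (2 * k + 1) = black P u"
      "inv P (2 * l + 1) = mate (black P u)"
    using inv_P(1)[OF bij, of u] inv_P(1)[OF bij, of "mate u"] inv_P(1)[OF bij, of "black P u"]
      inv_P(1)[OF bij, of "mate (black P u)"] unfolding u by auto
  have pos: "P v = 2 * k \<longleftrightarrow> v = u" "P v = 2 * l \<longleftrightarrow> v = mate u" "P v = 2 * k + 1 \<longleftrightarrow> v = black P u"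
      "P v = 2 * l + 1 \<longleftrightarrow> v = mate (black P u)" for v
    using inj_P_iff[OF bij, of v u] inj_P_iff[OF bij, of v "mate u"] inj_P_iff[OF bij, of v "black P u"]
      inj_P_iff[OF bij, of v "mate (black P u)"] unfolding u by auto
  have ne: "black P u \<noteq> mate u" using u by auto
  then have ne': "mate (black P u) \<noteq> u" by (metis mate_mate)
  show b: "black P' v = (if v \<in> cyc P u then mate v else black P v)" for v
    unfolding P'_def black_rv[OF bij kl] pos inv cyc_def using ne ne' by auto
  have cm: "mate v \<in> cyc P u \<longleftrightarrow> v \<in> cyc P u" for v by (auto simp: cyc_def mate_eq_swap)
  show "black_commutes P'"
    by (simp add: black_commutes_def b cm commutes[OF com])
  have sub: "cyc P u \<subseteq> nontrivial P"
    using ne ne' ne'[symmetric] bij by (auto simp: nontrivial_def cyc_def commutes[OF com])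
  have "nontrivial P' = nontrivial P - cyc P u" by (auto simp: nontrivial_def b)
  moreover have "card (cyc P u) = 4"
    using ne ne' ne'[symmetric] bij by (auto simp: cyc_def card_insert_if)
  ultimately show "card (nontrivial P') + 4 = card (nontrivial P)"
    using sub finite_nontrivial[OF P] card_mono[OF finite_nontrivial[OF P] sub]
    by (simp add: card_Diff_subset finite_subset)
qed

text \<open>Conjugation: the flip at \<open>l\<close> brings the block to the front, where the flip
  at \<open>l - k\<close> reverses it, and the flip at \<open>l\<close> restores everything
  else.\<close>

lemma rv_via_flips:
  assumes "1 \<le> k" "k < l"
  shows "flips [l, l - k, l] P = rv k l \<circ> P"
proof -
  obtain d where l: "l = k + d" using assms(2) less_imp_add_positive by blast
  have "rv 0 l (rv 0 (l - k) (rv 0 l p)) = rv k l p" for p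
  proof -
    consider "p = 0 \<or> 2 * l < p" | "1 \<le> p" "p \<le> 2 * k" | "2 * k + 1 \<le> p" "p \<le> 2 * l" by linarith
    then show ?thesis
    proof cases
      case 2
      then have "rv 0 l p = 2 * l + 1 - p" "2 * (l - k) < rv 0 l p" by (auto simp: rv_def l)
      then have "rv 0 (l - k) (rv 0 l p) = rv 0 l p" by (intro rv_outside) simp
      then show ?thesis using 2 by (simp add: rv_outside)
    next
      case 3
      then have "rv 0 l p = 2 * l + 1 - p" by (simp add: rv_def)
      moreover have "1 \<le> 2 * l + 1 - p" "2 * l + 1 - p \<le> 2 * (l - k)" using 3 by (auto simp: l)
      then have "rv 0 (l - k) (2 * l + 1 - p) = p - 2 * k" using 3 by (simp add: rv_def l)
      moreover have "1 \<le> p - 2 * k" "p - 2 * k \<le> 2 * l" using 3 by auto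
      then have "rv 0 l (p - 2 * k) = rv k l p" using 3 by (simp add: rv_def)
      ultimately show ?thesis by simp
    qed (auto simp: rv_outside)
  qed
  then show ?thesis by (auto simp: fun_eq_iff)
qed

text \<open>
  Removing an oriented cycle closest to the leftmost one turns its predecessor on a shortest path
  into an oriented cycle and leaves the rest of the path alone.
\<close>

lemma remove_closest_oriented:
  assumes P: "adm n P" and com: "black_commutes P" and nonor: "\<not> oriented P 0"
    and ex: "\<exists>v \<in> leftmost_labels P. oriented P v"
  obtains w where "oriented P w"
    "\<And>u k l. u \<in> cyc P w \<Longrightarrow> k < l \<Longrightarrow> P u = 2 * k \<Longrightarrow> P (mate u) = 2 * l \<Longrightarrow>
       \<exists>v \<in> leftmost_labels (rv k l \<circ> P). oriented (rv k l \<circ> P) v"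
proof -
  note bij = adm_bij[OF P]
  \<comment> \<open>Only crossings between different cycles count as steps, so that
    \<open>crosses_cyc\<close> applies and a label may be replaced by any other on its
    cycle.\<close>
  define A where "A = {(u, v). crosses P u v \<and> v \<notin> cyc P u}"
  have self: "v \<in> cyc P v" for v by (simp add: cyc_def)
  have reach: "\<exists>w \<in> cyc P v. (0, w) \<in> A\<^sup>*" if "v \<in> leftmost_labels P" for v
    using that
  proof (induction rule: leftmost_labels_induct)
    case zero
    then show ?case using self by blast
  next
    case (black u)
    have "cyc P (black P u) = cyc P u" by (rule cyc_eq[OF bij com]) (simp add: cyc_def)
    with black show ?case by simp
  next
    case (mate u)
    have "cyc P (mate u) = cyc P u" by (rule cyc_eq[OF bij com]) (simp add: cyc_def)
    with mate show ?case by simp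
  next
    case (crosses u v)
    then obtain w where w: "w \<in> cyc P u" "(0, w) \<in> A\<^sup>*" by auto
    show ?case
    proof (cases "v \<in> cyc P u")
      case True
      then show ?thesis using w cyc_eq[OF bij com True] by auto
    next
      case False
      then have "(w, v) \<in> A"
        using crosses(3) crosses_cyc[OF bij com w(1) False] cyc_eq[OF bij com w(1)] by (simp add: A_def)
      with w(2) have "(0, v) \<in> A\<^sup>*" by (rule rtrancl_into_rtrancl)
      then show ?thesis using self[of v] by (rule_tac bexI)
    qed
  qed
  define reach_in where "reach_in d \<longleftrightarrow> (\<exists>w. oriented P w \<and> (0, w) \<in> A ^^ d)" for d
  define d where "d = (LEAST d. reach_in d)"
  obtain v where v: "v \<in> leftmost_labels P" "oriented P v" using ex by blast
  obtain w0 where w0: "w0 \<in> cyc P v" "(0, w0) \<in> A\<^sup>*" using reach[OF v(1)] by blast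
  obtain i where "(0, w0) \<in> A ^^ i" using rtrancl_imp_relpow[OF w0(2)] by blast
  moreover have "oriented P w0" using v(2) oriented_cyc[OF bij com w0(1)] by simp
  ultimately have "\<exists>d. reach_in d" unfolding reach_in_def by (intro exI conjI)
  then have d: "reach_in d" unfolding d_def by (rule LeastI_ex)
  have least: "\<not> reach_in i" if "i < d" for i using not_less_Least that unfolding d_def by blast
  from d obtain w where w: "oriented P w" "(0, w) \<in> A ^^ d" by (auto simp: reach_in_def)
  have "d \<noteq> 0"
  proof
    assume "d = 0"
    with w nonor show False by simp
  qed
  then obtain e where e: "d = Suc e" by (cases d) auto
  obtain f where f: "f 0 = 0" "f d = w" "\<And>i. i < d \<Longrightarrow> (f i, f (Suc i)) \<in> A"
    using w(2) unfolding relpow_fun_conv by auto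
  have pre: "(0, f i) \<in> A ^^ i" if "i \<le> d" for i
    unfolding relpow_fun_conv using f that by (intro exI[of _ f]) auto
  have non: "\<not> oriented P (f i)" if "i \<le> e" for i
    using least[of i] pre[of i] that e by (auto simp: reach_in_def)
  have away: "f i \<notin> cyc P w" if "i \<le> e" for i
    using oriented_cyc[OF bij com, of "f i" w] non[OF that] w(1) by blast
  \<comment> \<open>A direct crossing would give a shorter path to an oriented cycle.\<close>
  have indirect: "\<not> crosses P (f i) w" if "i < e" for i
  proof
    assume "crosses P (f i) w"
    then have "(f i, w) \<in> A"
      using away[of i] that by (simp add: A_def cyc_sym[OF bij com])
    then have "(0, w) \<in> A ^^ Suc i" using pre[of i] that e by auto
    then show False using least[of "Suc i"] that e w(1) by (auto simp: reach_in_def)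
  qed
  show ?thesis
  proof (rule that[OF w(1)])
    fix u k l assume u: "u \<in> cyc P w" "k < l" "P u = 2 * k" "P (mate u) = 2 * l"
    let ?P = "rv k l \<circ> P"
    have cross: "crosses P v w \<longleftrightarrow>
        (2 * k + 1 \<le> P v \<and> P v \<le> 2 * l) \<noteq> (2 * k + 1 \<le> P (mate v) \<and> P (mate v) \<le> 2 * l)"
      if v: "v \<notin> cyc P w" for v
    proof -
      have "mate v \<notin> cyc P w" using v by (auto simp: cyc_def mate_eq_swap)
      moreover have "mate u \<in> cyc P w" using u(1) by (auto simp: cyc_def)
      ultimately have "P v \<noteq> 2 * l" "P (mate v) \<noteq> 2 * l"
        using v u by (auto simp: inj_P_iff[OF bij] simp flip: u(4))
      then have "crosses P u v \<longleftrightarrow>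
          (2 * k + 1 \<le> P v \<and> P v \<le> 2 * l) \<noteq> (2 * k + 1 \<le> P (mate v) \<and> P (mate v) \<le> 2 * l)"
        using u by (simp add: crosses_def strictly_between_def) linarith
      then show ?thesis
        using crosses_cyc[OF bij com u(1) v] crosses_sym[OF bij] by blast
    qed
    \<comment> \<open>An edge not crossing \<open>w\<close> has both ends inside or both outside the
      reversed block, so its crossings survive. Only \<open>f e\<close> has one end inside, and it
      becomes oriented.\<close>
    have path: "f i \<in> leftmost_labels ?P" if "i \<le> e" for i
      using that
    proof (induction i)
      case 0
      then show ?case by (simp add: f(1))
    next
      case (Suc i)
      have "crosses P (f i) (f (Suc i))" using f(3)[of i] Suc.prems e by (simp add: A_def)
      moreover have "crosses ?P (f i) (f (Suc i)) = crosses P (f i) (f (Suc i))"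
        using indirect[of i] cross[OF away[of i]] Suc.prems unfolding crosses_def comp_apply
        by (simp add: strictly_between_rv)
      ultimately have "crosses ?P (f i) (f (Suc i))" by blast
      with Suc.IH Suc.prems show ?case by (metis Suc_leD leftmost_labels_step(3))
    qed
    have "crosses P (f e) w" using f(3)[of e] f(2) e by (simp add: A_def)
    then have "oriented ?P (f e)"
      using cross[OF away[of e]] non[of e] by (simp add: oriented_rv)
    then show "\<exists>v \<in> leftmost_labels ?P. oriented ?P v" using path[of e] by blast
  qed
qed

section \<open>The upper bound\<close>

text \<open>
  Four times the claimed distance of a simple permutation, as a cycle of length two has four labels.
\<close>

definition cost :: "(nat \<Rightarrow> nat) \<Rightarrow> int" where
  "cost P = 3 * int (card (nontrivial P)) +
     (if black P 0 = 1 then 0 else if \<exists>v \<in> leftmost_labels P. oriented P v then - 8 else - 4)"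

text \<open>A block of flips that leads to a simple arrangement again and pays for itself, at 4
  units of \<open>cost\<close> per flip; arrangements inside the block may fail to be
  simple.\<close>

definition reducible :: "nat \<Rightarrow> (nat \<Rightarrow> nat) \<Rightarrow> bool" where
  "reducible n P \<longleftrightarrow> (\<exists>ms. ms \<noteq> [] \<and> set ms \<subseteq> {1..n} \<and> black_commutes (flips ms P) \<and>
     cost (flips ms P) + 4 * int (length ms) \<le> cost P)"

lemma reducibleI:
  assumes "ms \<noteq> []" "set ms \<subseteq> {1..n}" "flips ms P = P'" "black_commutes P'"
    "cost P' + 4 * int (length ms) \<le> cost P"
  shows "reducible n P"
  using assms unfolding reducible_def by blast

lemma adm_flips: "adm n P \<Longrightarrow> set js \<subseteq> {1..n} \<Longrightarrow> adm n (flips js P)"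
proof (induction js arbitrary: P)
  case (Cons j js)
  have "adm n (rv 0 j \<circ> P)" using Cons.prems by (intro adm_rv) auto
  then have "adm n (flips js (rv 0 j \<circ> P))" by (rule Cons.IH) (use Cons.prems(2) in simp)
  then show ?case by (simp only: fold_simps)
qed simp

lemma position_le:
  assumes P: "adm n P" and v: "P v = 2 * l \<or> P v = 2 * l + 1" "P (mate v) \<noteq> mate (P v)"
  shows "l \<le> n"
proof -
  have "v < 2 * n + 2"
  proof (rule ccontr)
    assume "\<not> v < 2 * n + 2"
    then have "2 * n + 2 \<le> v" "2 * n + 2 \<le> mate v" using mate_less_iff[of v n] by linarith+
    then show False using v(2) adm_outside[OF P] by simp
  qed
  then have "P v < 2 * n + 2" using adm_in[OF P] by blast
  then show ?thesis using v(1) by linarith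
qed

lemma reducible_leftmost_oriented:
  assumes P: "adm n P" and com: "black_commutes P" and or: "oriented P 0"
  shows "reducible n P"
proof -
  note bij = adm_bij[OF P]
  obtain u k l where u: "u \<in> cyc P 0" "k < l" and pos: "P u = 2 * k" "P (mate u) = 2 * l"
    "P (black P u) = 2 * k + 1" "P (mate (black P u)) = 2 * l + 1"
    using oriented_position[OF bij com or] by blast
  have "0 \<in> cyc P u" using u(1) cyc_sym[OF bij com] by blast
  then have "P 0 = P u \<or> P 0 = P (mate u) \<or> P 0 = P (black P u) \<or> P 0 = P (mate (black P u))"
    unfolding cyc_def by (metis empty_iff insert_iff)
  then have k: "k = 0" unfolding pos using P u(2) by auto
  let ?P = "rv k l \<circ> P"
  note rem = remove_oriented[OF P com u(2) pos]
  have ln: "l \<le> n" using position_le[OF P, of "mate u" l] pos double_not_eq_Suc_double[of k l] by auto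
  have "black ?P 0 = 1" using rem(1)[of 0] \<open>0 \<in> cyc P u\<close> by simp
  \<comment> \<open>Removing four labels saves 12 and the bonus of 8 is lost, which leaves 4 for the
    single flip.\<close>
  moreover have "cost P \<ge> 3 * int (card (nontrivial P)) - 8" by (simp add: cost_def)
  ultimately have "cost ?P + 4 \<le> cost P" using rem(3) unfolding cost_def[of ?P] by simp
  then show ?thesis
    using rem(2) u(2) ln by (intro reducibleI[of "[l]" n P ?P]) (auto simp: k fun_eq_iff)
qed

lemma reducible_remove:
  assumes P: "adm n P" and com: "black_commutes P" and or: "oriented P w" and non0: "\<not> oriented P 0"
    and keep: "black P 0 = 1 \<or> (\<forall>u k l. u \<in> cyc P w \<longrightarrow> k < l \<longrightarrow> P u = 2 * k \<longrightarrow> P (mate u) = 2 * l \<longrightarrow>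
       (\<exists>v \<in> leftmost_labels (rv k l \<circ> P). oriented (rv k l \<circ> P) v))"
  shows "reducible n P"
proof -
  note bij = adm_bij[OF P]
  obtain u k l where u: "u \<in> cyc P w" "k < l" and pos: "P u = 2 * k" "P (mate u) = 2 * l"
    "P (black P u) = 2 * k + 1" "P (mate (black P u)) = 2 * l + 1"
    using oriented_position[OF bij com or] by blast
  let ?P = "rv k l \<circ> P"
  note rem = remove_oriented[OF P com u(2) pos]
  have "oriented P u" using oriented_cyc[OF bij com u(1)] or by simp
  then have zero: "0 \<notin> cyc P u" using oriented_cyc[OF bij com, of 0 u] non0 by blast
  \<comment> \<open>The block lies behind a nonempty prefix, as \<open>rv_via_flips\<close>
    requires.\<close>
  have "k \<noteq> 0"
  proof
    assume "k = 0"
    then have "u = 0" using pos(1) inj_P_iff[OF bij, of u 0] P by simp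
    then show False using zero by (simp add: cyc_def)
  qed
  have ln: "l \<le> n" using position_le[OF P, of "mate u" l] pos double_not_eq_Suc_double[of k l] by auto
  have b0: "black ?P 0 = black P 0" using rem(1)[of 0] zero by simp
  have "cost ?P + 12 \<le> cost P"
  proof (cases "black P 0 = 1")
    case True
    then show ?thesis using rem(3) b0 unfolding cost_def by simp
  next
    case False
    then have "\<exists>v \<in> leftmost_labels ?P. oriented ?P v" using keep u pos by blast
    then show ?thesis using rem(3) b0 False unfolding cost_def by simp
  qed
  moreover have "flips [l, l - k, l] P = ?P" using \<open>k \<noteq> 0\<close> u(2) by (intro rv_via_flips) auto
  ultimately show ?thesis
    using rem(2) u(2) ln by (intro reducibleI[of "[l, l - k, l]" n P ?P]) auto
qed

text \<open>Flipping at the far end of the leftmost cycle only rejoins its four labels the other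
  way. Some grey edge leaves the flipped prefix; it crosses the edge at 0 before and after, and
  turns oriented. The bonus grows from 4 to 8.\<close>

lemma reducible_leftmost_nonoriented:
  assumes P: "adm n P" and com: "black_commutes P" and b01: "black P 0 \<noteq> 1"
    and nonor: "\<And>v. v \<in> leftmost_labels P \<Longrightarrow> \<not> oriented P v"
  shows "reducible n P"
proof -
  note bij = adm_bij[OF P]
  have "odd (P 1)" using nonor[of 0] P by (simp add: oriented_def)
  then obtain l where l: "P 1 = 2 * l + 1" by (auto elim: oddE)
  have "l \<noteq> 0" using l b01 adm_1_iff[OF P] by auto
  then have ln: "l \<le> n" using position_le[OF P, of 1 l] l P \<open>l \<noteq> 0\<close> by simp
  define x where "x = black P 0"
  have x: "P x = 1" "P (mate x) = 2 * l" "black P x = 0"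
    using bij P l commutes[OF com, of 0] by (simp_all add: x_def flip: commutes[OF com])
  have neq: "x \<noteq> 0" "x \<noteq> 1" "mate x \<noteq> 0" "mate x \<noteq> 1"
    using x P l \<open>l \<noteq> 0\<close> b01 black_neq(1)[OF bij, of 0] by (auto simp: x_def)
  have bm: "black P (mate x) = 1" "black P 1 = mate x"
    using commutes[OF com, of x] commutes[OF com, of 0] x(3) by (simp_all add: x_def)
  let ?P = "rv 0 l \<circ> P"
  have inv: "inv P 0 = 0" "inv P 1 = x" "inv P (2 * l) = mate x" "inv P (2 * l + 1) = 1"
    using inv_P(1)[OF bij, of 0] inv_P(1)[OF bij, of x] inv_P(1)[OF bij, of "mate x"] inv_P(1)[OF bij, of 1] P
    unfolding x l by auto
  have pos: "P v = 0 \<longleftrightarrow> v = 0" "P v = 1 \<longleftrightarrow> v = x" "P v = 2 * l \<longleftrightarrow> v = mate x" "P v = 2 * l + 1 \<longleftrightarrow> v = 1" for v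
    using inj_P_iff[OF bij, of v 0] inj_P_iff[OF bij, of v x] inj_P_iff[OF bij, of v "mate x"]
      inj_P_iff[OF bij, of v 1] P unfolding x l by auto
  have b: "black ?P v = (if v = 0 then mate x else if v = x then 1 else if v = mate x then 0
      else if v = 1 then x else black P v)" for v
    using black_rv[OF bij, of 0 l v] \<open>l \<noteq> 0\<close> unfolding mult_0_right add_0 pos inv by auto
  have com': "black_commutes ?P"
    unfolding black_commutes_def b using neq commutes[OF com] by (auto simp: mate_eq_swap)
  have "nontrivial ?P = nontrivial P"
  proof (rule set_eqI)
    fix v
    consider "v = 0" | "v = 1" | "v = x" | "v = mate x" | "v \<notin> {0, 1, x, mate x}" by blast
    then show "v \<in> nontrivial ?P \<longleftrightarrow> v \<in> nontrivial P"
      unfolding nontrivial_def mem_Collect_eq b by cases (use neq b01 x bm in \<open>auto simp: x_def\<close>)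
  qed
  obtain u where u: "(2 * 0 + 1 \<le> P u \<and> P u \<le> 2 * l) \<noteq> (2 * 0 + 1 \<le> P (mate u) \<and> P (mate u) \<le> 2 * l)"
    using ex_crossing[OF P, of 0 l] \<open>l \<noteq> 0\<close> ln by auto
  have sb: "strictly_between 0 (2 * l + 1) p \<longleftrightarrow> 2 * 0 + 1 \<le> p \<and> p \<le> 2 * l" for p
    by (auto simp: strictly_between_def)
  have "crosses P 0 u" using u P l unfolding crosses_def sb mate_0 adm_0[OF P] l by simp
  then have "\<not> oriented P u" using nonor leftmost_labels_step(3)[of 0 P u] by simp
  then have or: "oriented ?P u" using u by (simp add: oriented_rv)
  have P': "?P 0 = 0" "?P 1 = 2 * l + 1" using P l by (simp_all add: rv_outside)
  have "crosses ?P 0 u"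
    unfolding crosses_def mate_0 P' sb unfolding comp_apply rv_in_iff using u by simp
  then have "u \<in> leftmost_labels ?P" using leftmost_labels_step(3)[of 0 ?P u] by simp
  then have "\<exists>v \<in> leftmost_labels ?P. oriented ?P v" using or by blast
  then have "cost ?P + 4 \<le> cost P"
    using b[of 0] neq b01 nonor \<open>nontrivial ?P = nontrivial P\<close> by (auto simp: cost_def)
  then show ?thesis
    using com' ln \<open>l \<noteq> 0\<close> by (intro reducibleI[of "[l]" n P ?P]) auto
qed

text \<open>Net effect: the first k elements move behind the block unreversed, by an even shift of
  positions, and the block comes to the front reversed.\<close>

lemma flip_flip_positions:
  assumes "k < l"
  shows "rv 0 l (rv 0 k p) = (if p = 0 \<or> 2 * l < p then p else if p \<le> 2 * k then p + 2 * (l - k) else 2 * l + 1 - p)"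
proof -
  consider "p = 0 \<or> 2 * l < p" | "1 \<le> p" "p \<le> 2 * k" | "2 * k + 1 \<le> p" "p \<le> 2 * l" by linarith
  then show ?thesis
  proof cases
    case 1
    then show ?thesis using assms by (auto simp: rv_outside)
  next
    case 2
    then have "rv 0 k p = 2 * k + 1 - p" by (simp add: rv_def)
    moreover have "1 \<le> 2 * k + 1 - p" "2 * k + 1 - p \<le> 2 * l" using 2 assms by auto
    ultimately show ?thesis using 2 assms by (simp add: rv_def)
  next
    case 3
    then show ?thesis by (simp add: rv_outside) (simp add: rv_def)
  qed
qed

lemma nonoriented_position:
  assumes bij: "bij P" and com: "black_commutes P" and non: "\<not> oriented P v" "black P v \<noteq> mate v"
  obtains u k l where "k < l" "P u = 2 * k" "P (mate u) = 2 * l + 1"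
    "P (black P u) = 2 * k + 1" "P (mate (black P u)) = 2 * l" "u \<in> cyc P v"
proof -
  define w where "w = (if even (P v) then v else mate v)"
  have "mate (black P v) \<noteq> v" using non(2) by (metis mate_mate)
  then have w: "even (P w)" "odd (P (mate w))" "black P w \<noteq> mate w" "w \<in> cyc P v"
    using non by (auto simp: w_def oriented_def cyc_def commutes[OF com])
  then obtain a b where ab: "P w = 2 * a" "P (mate w) = 2 * b + 1" by (auto elim!: evenE oddE)
  have bw: "P (black P w) = 2 * a + 1" "P (mate (black P w)) = 2 * b"
    using ab bij by (simp_all flip: commutes[OF com])
  then have "a \<noteq> b" using w(3) ab inj_P_iff[OF bij, of "black P w" "mate w"] by auto
  show ?thesis
  proof (cases "a < b")
    case True
    then show ?thesis using that ab bw w(4) by blast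
  next
    case False
    \<comment> \<open>The other label of the cycle at an even position, which is now the left
      one.\<close>
    let ?u = "mate (black P w)"
    have "?u \<in> cyc P w" by (simp add: cyc_def)
    then have "?u \<in> cyc P v" using cyc_eq[OF bij com w(4)] by simp
    moreover have "black P ?u = mate w" using bij by (simp add: commutes[OF com])
    ultimately show ?thesis using that[of b a ?u] False \<open>a \<noteq> b\<close> ab bw by simp
  qed
qed

text \<open>After the flips at k and l, \<open>u\<close> and \<open>mate u\<close> form a cycle of
  length one, and 0, 1 take their places in a cycle of length two. The number of nontrivial labels
  is unchanged, but the leftmost component is oriented: a bonus of 8 for two flips.\<close>

lemma reducible_nonoriented:
  assumes P: "adm n P" and com: "black_commutes P" and b01: "black P 0 = 1"
    and nonor: "\<And>v. \<not> oriented P v" and nontriv: "v \<in> nontrivial P"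
  shows "reducible n P"
proof -
  note bij = adm_bij[OF P]
  obtain u k l where kl: "k < l" and u: "P u = 2 * k" "P (mate u) = 2 * l + 1"
    and s: "P (black P u) = 2 * k + 1" "P (mate (black P u)) = 2 * l"
    using nonoriented_position[OF bij com nonor[of v]] nontriv unfolding nontrivial_def by blast
  define s y where "s = black P u" and "y = mate (black P u)"
  have sy: "y = mate s" "mate y = s" by (simp_all add: s_def y_def)
  have blk: "black P u = s" "black P s = u" "black P (mate u) = y" "black P y = mate u"
    using bij by (simp_all add: s_def y_def commutes[OF com])
  have ps: "P s = 2 * k + 1" "P y = 2 * l" using s by (simp_all add: s_def y_def)
  have P1: "P 1 = 1" using b01 adm_1_iff[OF P] by simp
  have b1: "black P 1 = 0" using b01 black_black[OF bij, of 0] by simp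
  have k0: "k \<noteq> 0"
  proof
    assume "k = 0"
    then have "u = 0" using u(1) inj_P_iff[OF bij, of u 0] P by simp
    then show False using u(2) P1 kl by simp
  qed
  have ln: "l \<le> n" using position_le[OF P, of y l] ps kl sy by auto
  let ?P = "rv 0 l \<circ> (rv 0 k \<circ> P)"
  have Pp: "?P v = (if P v = 0 \<or> 2 * l < P v then P v else if P v \<le> 2 * k then P v + 2 * (l - k) else 2 * l + 1 - P v)" for v
    using flip_flip_positions[OF kl] by simp
  have val: "?P 0 = 0" "?P 1 = 2 * (l - k) + 1" "?P u = 2 * l" "?P (mate u) = 2 * l + 1" "?P s = 2 * (l - k)" "?P y = 1"
    unfolding Pp using P P1 u ps kl k0 by (auto simp: diff_mult_distrib2)
  have adm1: "adm n (rv 0 k \<circ> P)" using P kl ln by (intro adm_rv) auto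
  have adm': "adm n ?P" by (rule adm_rv[OF adm1 ln])
  note bij' = adm_bij[OF adm'] and bij1 = adm_bij[OF adm1]
  have dist: "distinct [0, 1, u, mate u, s, y]"
  proof -
    have "distinct (map P [0, 1, u, mate u, s, y])" using P P1 u ps kl k0 by simp
    then show ?thesis by (simp only: distinct_map)
  qed
  have "black ?P 0 = y" "black ?P y = 0" "black ?P u = mate u" "black ?P (mate u) = u"
     "black ?P s = 1" "black ?P 1 = s"
    unfolding black_eq_iff[OF bij'] val by simp_all
  moreover have "black ?P v = black P v" if "v \<notin> {0, 1, u, mate u, s, y}" for v
  proof -
    have "P v \<notin> {P 0, P 1, P u, P (mate u), P s, P y}" using that by (simp add: inj_P_iff[OF bij])
    then have ne: "P v \<notin> {0, 1, 2 * k, 2 * k + 1, 2 * l, 2 * l + 1}" unfolding u ps P1 adm_0[OF P] by auto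
    have "black (rv 0 k \<circ> P) v = black P v"
      using ne black_rv[OF bij, of 0 k v] k0 by auto
    moreover have "rv 0 k (P v) \<notin> {0, 1, 2 * l, 2 * l + 1}"
      using ne kl by (auto simp: rv_def)
    then have "black ?P v = black (rv 0 k \<circ> P) v"
      using black_rv[OF bij1, of 0 l v] kl by auto
    ultimately show ?thesis by simp
  qed
  ultimately have b: "black ?P v = (if v = 0 then y else if v = y then 0 else if v = u then mate u else
      if v = mate u then u else if v = s then 1 else if v = 1 then s else black P v)" for v
    by auto
  have com': "black_commutes ?P"
    unfolding black_commutes_def
  proof
    fix v
    consider "v = 0" | "v = 1" | "v = u" | "v = mate u" | "v = s" | "v = y" | "v \<notin> {0, 1, u, mate u, s, y}" by blast
    then show "black ?P (mate v) = mate (black ?P v)"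
    proof cases
      case 7
      then have "mate v \<notin> {0, 1, u, mate u, s, y}" using sy by (auto simp: mate_eq_swap)
      with 7 show ?thesis unfolding b by (simp add: commutes[OF com])
    qed (use dist sy in \<open>auto simp: b\<close>)
  qed
  have nt: "nontrivial ?P = (nontrivial P - {u, mate u}) \<union> {0, 1}"
  proof (rule set_eqI)
    fix v
    consider "v = 0" | "v = 1" | "v = u" | "v = mate u" | "v = s" | "v = y" | "v \<notin> {0, 1, u, mate u, s, y}" by blast
    then show "v \<in> nontrivial ?P \<longleftrightarrow> v \<in> (nontrivial P - {u, mate u}) \<union> {0, 1}"
      unfolding nontrivial_def b by cases (use dist sy blk in auto)
  qed
  have sub: "{u, mate u} \<subseteq> nontrivial P" using dist blk by (auto simp: nontrivial_def)
  have out: "0 \<notin> nontrivial P" "1 \<notin> nontrivial P" using b01 b1 by (auto simp: nontrivial_def)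
  have "card (nontrivial ?P) = card (nontrivial P - {u, mate u}) + 2"
    unfolding nt using out finite_nontrivial[OF P] by (subst card_Un_disjoint) auto
  also have "\<dots> = card (nontrivial P)"
    using sub finite_nontrivial[OF P] card_mono[OF finite_nontrivial[OF P] sub] by (subst card_Diff_subset) auto
  finally have card: "card (nontrivial ?P) = card (nontrivial P)" .
  obtain w where w: "(2 * k + 1 \<le> P w \<and> P w \<le> 2 * l) \<noteq> (2 * k + 1 \<le> P (mate w) \<and> P (mate w) \<le> 2 * l)"
    using ex_crossing[OF P kl ln] by blast
  have par: "even (?P v) \<longleftrightarrow> (even (P v) \<longleftrightarrow> \<not> (2 * k + 1 \<le> P v \<and> P v \<le> 2 * l))" for v
    unfolding Pp using kl by auto
  have "oriented ?P w" using nonor[of w] w unfolding oriented_def par by blast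
  \<comment> \<open>The reversed block now fills exactly the interval of the grey edge from 0 to 1,
    so what left the block crosses that edge.\<close>
  moreover have "strictly_between 0 (2 * (l - k) + 1) (?P v) \<longleftrightarrow> 2 * k + 1 \<le> P v \<and> P v \<le> 2 * l" for v
    unfolding Pp strictly_between_def using kl by (auto split: if_splits)
  then have "crosses ?P 0 w" unfolding crosses_def mate_0 val using w by simp
  then have "w \<in> leftmost_labels ?P" using leftmost_labels_step(3)[of 0 ?P w] by simp
  ultimately have "\<exists>v \<in> leftmost_labels ?P. oriented ?P v" by blast
  moreover have "black ?P 0 \<noteq> 1" using b[of 0] dist by auto
  ultimately have "cost ?P + 8 \<le> cost P" using card b01 by (simp add: cost_def)
  then show ?thesis
    using com' ln kl k0 by (intro reducibleI[of "[k, l]" n P ?P]) auto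
qed

lemma reducible_of_nontrivial:
  assumes P: "adm n P" and com: "black_commutes P" and nt: "nontrivial P \<noteq> {}"
  shows "reducible n P"
proof (cases "black P 0 = 1")
  case True
  then have non0: "\<not> oriented P 0" using oriented_nontrivial[OF adm_bij[OF P], of 0] by auto
  show ?thesis
  proof (cases "\<exists>v. oriented P v")
    case True
    then show ?thesis using reducible_remove[OF P com _ non0] \<open>black P 0 = 1\<close> by blast
  next
    case False
    then show ?thesis using reducible_nonoriented[OF P com \<open>black P 0 = 1\<close>] nt by blast
  qed
next
  case False
  consider "oriented P 0" | "\<not> oriented P 0" "\<exists>v \<in> leftmost_labels P. oriented P v"
    | "\<And>v. v \<in> leftmost_labels P \<Longrightarrow> \<not> oriented P v"
    by blast
  then show ?thesis
  proof cases
    case 1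
    then show ?thesis by (rule reducible_leftmost_oriented[OF P com])
  next
    case 2
    obtain w where "oriented P w"
      "\<And>u k l. u \<in> cyc P w \<Longrightarrow> k < l \<Longrightarrow> P u = 2 * k \<Longrightarrow> P (mate u) = 2 * l \<Longrightarrow>
       \<exists>v \<in> leftmost_labels (rv k l \<circ> P). oriented (rv k l \<circ> P) v"
      using remove_closest_oriented[OF P com 2] by metis
    then show ?thesis using reducible_remove[OF P com _ 2(1)] by blast
  next
    case 3
    then show ?thesis by (rule reducible_leftmost_nonoriented[OF P com False])
  qed
qed

lemma ex_sorting_of_cost:
  assumes "adm n P" "black_commutes P"
  shows "\<exists>js. set js \<subseteq> {1..n} \<and> flips js P = id \<and> 4 * int (length js) \<le> cost P"
  using assms
\<comment> \<open>\<open>cost\<close> is at least -8, which the shift turns into a natural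
  measure.\<close>
proof (induction "nat (cost P + 8)" arbitrary: P rule: less_induct)
  case less
  show ?case
  proof (cases "nontrivial P = {}")
    case True
    then have "P = id" using eq_id_of_trivial less.prems by blast
    moreover have "black P 0 = 1" using True by (auto simp: nontrivial_def)
    ultimately show ?thesis using True by (intro exI[of _ "[]"]) (simp add: cost_def)
  next
    case False
    then obtain ms where ms: "ms \<noteq> []" "set ms \<subseteq> {1..n}" "black_commutes (flips ms P)"
      "cost (flips ms P) + 4 * int (length ms) \<le> cost P"
      using reducible_of_nontrivial less.prems unfolding reducible_def by blast
    have "cost (flips ms P) \<ge> - 8" by (simp add: cost_def)
    moreover have "length ms > 0" using ms(1) by simp
    ultimately have "nat (cost (flips ms P) + 8) < nat (cost P + 8)" using ms(4) by linarith
    from less.hyps[OF this adm_flips[OF less.prems(1) ms(2)] ms(3)]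
    obtain js where js: "set js \<subseteq> {1..n}" "flips js (flips ms P) = id" "4 * int (length js) \<le> cost (flips ms P)"
      by blast
    then have "flips (ms @ js) P = id" by (simp only: fold_append comp_apply)
    then show ?thesis using js ms by (intro exI[of _ "ms @ js"]) auto
  qed
qed

section \<open>From signed permutations to arrangements\<close>

definition lab :: "int list \<Rightarrow> nat \<Rightarrow> nat" where
  "lab xs p = (if p < 2 * length xs + 2 then nat (labels xs ! p) else p)"

text \<open>The function \<open>P\<close> of the preceding sections, for a signed
  permutation.\<close>

definition pos :: "int list \<Rightarrow> nat \<Rightarrow> nat" where
  "pos xs = inv (lab xs)"

lemma length_concat_pairs: "(\<And>x. length (f x) = 2) \<Longrightarrow> length (concat (map f xs)) = 2 * length xs"
  by (induction xs) auto

lemma nth_concat_pairs: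
  assumes "\<And>x. length (f x) = 2" "i < length xs"
  shows "concat (map f xs) ! (2 * i) = f (xs ! i) ! 0" "concat (map f xs) ! (Suc (2 * i)) = f (xs ! i) ! 1"
  using assms(2)
proof (induction xs arbitrary: i)
  case (Cons x xs)
  {
    case 1
    then show ?case using Cons.IH(1)[of "i - 1"] assms(1)[of x] by (cases i) (auto simp: nth_append)
  next
    case 2
    then show ?case using Cons.IH(2)[of "i - 1"] assms(1)[of x] by (cases i) (auto simp: nth_append)
  }
qed auto

lemma length_labels [simp]: "length (labels xs) = 2 * length xs + 2"
  by (simp add: labels_def length_concat_pairs)

lemma labels_nth:
  "labels xs ! 0 = 0" "labels xs ! (Suc (2 * length xs)) = 2 * int (length xs) + 1"
  "i < length xs \<Longrightarrow> labels xs ! (Suc (2 * i)) = (if xs ! i > 0 then 2 * xs ! i - 1 else 2 * \<bar>xs ! i\<bar>)"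
  "i < length xs \<Longrightarrow> labels xs ! (Suc (Suc (2 * i))) = (if xs ! i > 0 then 2 * xs ! i else 2 * \<bar>xs ! i\<bar> - 1)"
  by (auto simp: labels_def nth_append length_concat_pairs nth_concat_pairs)

lemma lab_nth:
  "lab xs 0 = 0" "lab xs (Suc (2 * length xs)) = Suc (2 * length xs)"
  "i < length xs \<Longrightarrow> lab xs (Suc (2 * i)) = nat (if xs ! i > 0 then 2 * xs ! i - 1 else 2 * \<bar>xs ! i\<bar>)"
  "i < length xs \<Longrightarrow> lab xs (Suc (Suc (2 * i))) = nat (if xs ! i > 0 then 2 * xs ! i else 2 * \<bar>xs ! i\<bar> - 1)"
  "p \<ge> 2 * length xs + 2 \<Longrightarrow> lab xs p = p"
  by (auto simp: lab_def labels_nth)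

lemma position_cases:
  obtains "p = 0" | "p = Suc (2 * n)" | "2 * n + 2 \<le> p"
    | i where "i < n" "p = Suc (2 * i)" | i where "i < n" "p = Suc (Suc (2 * i))"
proof (cases p rule: elem_cases)
  case (2 i)
  then show ?thesis using that by (cases i n rule: linorder_cases) auto
next
  case (3 i)
  then show ?thesis using that by (cases "i < n") auto
qed (use that in auto)

lemma signed_permD:
  assumes "signed_perm n xs"
  shows "length xs = n" "i < n \<Longrightarrow> xs ! i \<noteq> 0" "k \<in> {1..int n} \<Longrightarrow> \<exists>i < n. \<bar>xs ! i\<bar> = k"
    "i < n \<Longrightarrow> \<bar>xs ! i\<bar> \<le> int n"
proof -
  have len: "length xs = n" and set: "abs ` set xs = {1..int n}"
    using assms by (auto simp: signed_perm_def)
  have rng: "\<bar>xs ! i\<bar> \<in> {1..int n}" if "i < n" for i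
    using that len set[symmetric] by auto
  show "length xs = n" by fact
  show "i < n \<Longrightarrow> xs ! i \<noteq> 0" "i < n \<Longrightarrow> \<bar>xs ! i\<bar> \<le> int n" using rng[of i] by auto
  assume "k \<in> {1..int n}"
  then have "k \<in> abs ` set xs" using set by simp
  then show "\<exists>i < n. \<bar>xs ! i\<bar> = k" using len by (auto simp: in_set_conv_nth)
qed

lemma lab_permutes:
  assumes "signed_perm n xs"
  shows "lab xs permutes {..<2 * n + 2}"
proof (rule bij_imp_permutes)
  note xs = signed_permD[OF assms]
  let ?V = "{..<2 * n + 2}"
  have sub: "?V \<subseteq> lab xs ` ?V"
  proof
    fix w assume "w \<in> ?V"
    then consider "w = 0" | "w = Suc (2 * n)" | i where "i < n" "w = Suc (2 * i) \<or> w = Suc (Suc (2 * i))"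
        by (cases rule: position_cases[where p = w and n = n]) auto
    then show "w \<in> lab xs ` ?V"
    proof cases
      case 1
      then show ?thesis by (intro image_eqI[of _ _ 0]) (auto simp: lab_nth)
    next
      case 2
      then show ?thesis using lab_nth(2)[of xs] xs(1) by (intro image_eqI[of _ _ "Suc (2 * n)"]) auto
    next
      case (3 i)
      obtain m where m: "m < n" "\<bar>xs ! m\<bar> = int (Suc i)" using xs(3)[of "int (Suc i)"] 3(1) by auto
      then have "w = lab xs (Suc (2 * m)) \<or> w = lab xs (Suc (Suc (2 * m)))"
        using 3 lab_nth(3,4)[of m xs] xs(1) by (auto simp: abs_if split: if_splits)
      then show ?thesis using m(1) by auto
    qed
  qed
  have "card (lab xs ` ?V) \<le> card ?V" by (rule card_image_le) simp
  then have eq: "lab xs ` ?V = ?V"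
    using sub by (intro card_seteq[symmetric]) auto
  then have "inj_on (lab xs) ?V" by (intro eq_card_imp_inj_on) auto
  then show "bij_betw (lab xs) ?V ?V" using eq by (simp add: bij_betw_def)
qed (use signed_permD(1)[OF assms] in \<open>simp add: lab_def\<close>)

lemma bij_lab: "signed_perm n xs \<Longrightarrow> bij (lab xs)"
  using lab_permutes permutes_bij by blast

lemma lab_elem_mate:
  assumes "signed_perm n xs"
  shows "lab xs (elem_mate p) = elem_mate (lab xs p)"
proof (cases rule: position_cases[where p = p and n = n])
  case 1
  then show ?thesis by (simp add: lab_nth elem_mate_def)
next
  case 2
  then show ?thesis using lab_nth(2)[of xs] signed_permD(1)[OF assms] by (simp add: lab_def)
next
  case 3
  then have "elem_mate p \<ge> 2 * n + 2 \<or> p = 2 * n + 2" by (auto simp: elem_mate_def)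
  then show ?thesis
    using 3 lab_nth(2)[of xs] signed_permD(1)[OF assms] by (auto simp: lab_nth(5))
next
  case (4 i)
  have "xs ! i \<noteq> 0" using 4 signed_permD(2)[OF assms] by blast
  then have "elem_mate (nat (2 * xs ! i - 1)) = nat (2 * xs ! i)" if "xs ! i > 0"
    using that by (auto simp: elem_mate_def even_nat_iff)
  moreover have "elem_mate (nat (- (2 * xs ! i))) = nat (- (2 * xs ! i) - 1)" if "xs ! i < 0"
    using that by (auto simp: elem_mate_def even_nat_iff)
  ultimately show ?thesis using 4 signed_permD(1)[OF assms] \<open>xs ! i \<noteq> 0\<close> by (auto simp: lab_nth)
next
  case (5 i)
  have "xs ! i \<noteq> 0" using 5 signed_permD(2)[OF assms] by blast
  have "elem_mate (nat (2 * xs ! i)) = nat (2 * xs ! i - 1)" if "xs ! i > 0"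
    using that by (auto simp: elem_mate_def even_nat_iff)
  moreover have "elem_mate (nat (- (2 * xs ! i) - 1)) = nat (- (2 * xs ! i))" if "xs ! i < 0"
    using that by (auto simp: elem_mate_def even_nat_iff)
  ultimately show ?thesis using 5 signed_permD(1)[OF assms] \<open>xs ! i \<noteq> 0\<close> by (auto simp: lab_nth)
qed

lemma lab_pos [simp]: "signed_perm n xs \<Longrightarrow> lab xs (pos xs v) = v"
  and pos_lab [simp]: "signed_perm n xs \<Longrightarrow> pos xs (lab xs p) = p"
  using bij_lab by (simp_all add: pos_def)

lemma inv_pos: "signed_perm n xs \<Longrightarrow> inv (pos xs) = lab xs"
  using bij_lab by (simp add: pos_def inv_inv_eq)

lemma adm_pos:
  assumes "signed_perm n xs"
  shows "adm n (pos xs)"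
  unfolding adm_def
proof (intro conjI allI)
  show "pos xs permutes {..<2 * n + 2}"
    unfolding pos_def by (rule permutes_inv[OF lab_permutes[OF assms]])
  fix v
  have "lab xs (elem_mate (pos xs v)) = elem_mate v" using assms by (simp add: lab_elem_mate)
  then show "pos xs (elem_mate v) = elem_mate (pos xs v)" using assms by (metis pos_lab)
qed

lemma length_prefix_signed_reversal [simp]: "length (prefix_signed_reversal j xs) = length xs"
  by (simp add: prefix_signed_reversal_def)

lemma prefix_signed_reversal_nth:
  assumes "j \<le> length xs" "i < length xs"
  shows "prefix_signed_reversal j xs ! i = (if i < j then - xs ! (j - i - 1) else xs ! i)"
  using assms by (auto simp: prefix_signed_reversal_def nth_append rev_nth min_def)

lemma signed_perm_prefix_signed_reversal:
  assumes "signed_perm n xs"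
  shows "signed_perm n (prefix_signed_reversal j xs)"
proof -
  have eq: "map abs (prefix_signed_reversal j xs) = rev (take j (map abs xs)) @ drop j (map abs xs)"
    by (simp add: prefix_signed_reversal_def take_map drop_map rev_map comp_def)
  have d: "distinct (rev (take j ys) @ drop j ys) \<longleftrightarrow> distinct ys" for ys :: "int list"
    by (metis append_take_drop_id distinct_append distinct_rev set_rev)
  have s: "set (rev (take j ys) @ drop j ys) = set ys" for ys :: "int list"
    by (metis append_take_drop_id set_append set_rev)
  show ?thesis using assms by (simp only: signed_perm_def eq d s length_prefix_signed_reversal)
qed

text \<open>A change of sign swaps the two labels of an element, which is what reflecting their
  positions does.\<close>

lemma lab_prefix_signed_reversal:
  assumes xs: "signed_perm n xs" and j: "j \<le> n"
  shows "lab (prefix_signed_reversal j xs) p = lab xs (rv 0 j p)"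
proof -
  have len: "length xs = n" using xs signed_permD(1) by blast
  show ?thesis
  proof (cases rule: position_cases[where p = p and n = n])
    case 1
    then show ?thesis by (simp add: lab_nth)
  next
    case 2
    then have "rv 0 j p = p" using j by (intro rv_outside) auto
    then show ?thesis using 2 lab_nth(2)[of xs] lab_nth(2)[of "prefix_signed_reversal j xs"] len by simp
  next
    case 3
    then have "rv 0 j p = p" using j by (intro rv_outside) auto
    then show ?thesis using 3 len by (simp add: lab_nth)
  next
    case (4 i)
    have "xs ! (j - i - 1) \<noteq> 0" if "i < j" using signed_permD(2)[OF xs] that j by simp
    then show ?thesis
      using 4 j len prefix_signed_reversal_nth[of j xs i] by (auto simp: rv_Suc lab_nth)
  next
    case (5 i)
    have "xs ! (j - i - 1) \<noteq> 0" if "i < j" using signed_permD(2)[OF xs] that j by simp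
    then show ?thesis
      using 5 j len prefix_signed_reversal_nth[of j xs i] by (auto simp: rv_Suc lab_nth)
  qed
qed

lemma pos_prefix_signed_reversal:
  assumes xs: "signed_perm n xs" and j: "j \<le> n"
  shows "pos (prefix_signed_reversal j xs) = rv 0 j \<circ> pos xs"
proof -
  have "lab (prefix_signed_reversal j xs) = lab xs \<circ> rv 0 j"
    using lab_prefix_signed_reversal[OF xs j] by (simp add: fun_eq_iff)
  then show ?thesis
    unfolding pos_def by (simp add: o_inv_distrib bij_lab[OF xs] bij_rv)
qed

lemma identity_iff:
  assumes xs: "signed_perm n xs"
  shows "xs = identity_perm n \<longleftrightarrow> pos xs = id"
proof -
  note len = signed_permD(1)[OF xs]
  have "pos xs = id \<longleftrightarrow> lab xs = id"
    using inv_pos[OF xs] by (metis inv_id pos_def)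
  also have "\<dots> \<longleftrightarrow> (\<forall>i < n. xs ! i = int i + 1)"
  proof
    assume id: "lab xs = id"
    show "\<forall>i < n. xs ! i = int i + 1"
    proof (intro allI impI)
      fix i assume "i < n"
      then have "nat (if xs ! i > 0 then 2 * xs ! i - 1 else 2 * \<bar>xs ! i\<bar>) = Suc (2 * i)"
        using id lab_nth(3)[of i xs] len by simp
      then show "xs ! i = int i + 1" by (auto simp: nat_eq_iff split: if_splits) presburger+
    qed
  next
    assume *: "\<forall>i < n. xs ! i = int i + 1"
    show "lab xs = id"
    proof
      fix p
      show "lab xs p = id p"
      proof (cases rule: position_cases[where p = p and n = n])
        case 2
        then show ?thesis using lab_nth(2)[of xs] len by simp
      next
        case (4 i)
        then show ?thesis using * lab_nth(3)[of i xs] len by auto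
      next
        case (5 i)
        then show ?thesis using * lab_nth(4)[of i xs] len by auto
      qed (auto simp: lab_nth len)
    qed
  qed
  also have "\<dots> \<longleftrightarrow> xs = identity_perm n"
    by (auto simp: identity_perm_def list_eq_iff_nth_eq len)
  finally show ?thesis by simp
qed

lemma sorts_iff:
  assumes "signed_perm n xs"
  shows "sorts js xs \<longleftrightarrow> set js \<subseteq> {1..n} \<and> flips js (pos xs) = id"
proof -
  have "fold prefix_signed_reversal js xs = identity_perm n \<longleftrightarrow> flips js (pos xs) = id"
    if "set js \<subseteq> {1..n}"
    using that assms
  proof (induction js arbitrary: xs)
    case Nil
    then show ?case using identity_iff[of n xs] by (simp add: id_def)
  next
    case (Cons j js)
    have "pos (prefix_signed_reversal j xs) = rv 0 j \<circ> pos xs"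
      using Cons.prems by (intro pos_prefix_signed_reversal) auto
    moreover have "signed_perm n (prefix_signed_reversal j xs)"
      using Cons.prems(2) by (rule signed_perm_prefix_signed_reversal)
    ultimately show ?case using Cons.IH[of "prefix_signed_reversal j xs"] Cons.prems(1)
      by (simp only: fold_simps list.set insert_subset)
  qed
  then show ?thesis using signed_permD(1)[OF assms] by (auto simp: sorts_def)
qed

section \<open>The breakpoint graph\<close>

definition alternates :: "('a \<Rightarrow> 'a) \<Rightarrow> ('a \<Rightarrow> 'a) \<Rightarrow> 'a list \<Rightarrow> nat \<Rightarrow> bool" where
  "alternates f g ps l \<longleftrightarrow> 1 \<le> l \<and> length ps = 2 * l \<and>
     (\<forall>i < l. ps ! (2 * i + 1) = f (ps ! (2 * i)) \<and> ps ! ((2 * i + 2) mod (2 * l)) = g (ps ! (2 * i + 1)))"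

lemma set_alternates:
  assumes f: "\<And>v. f (f v) = v" and g: "\<And>v. g (g v) = v" and ps: "alternates f g ps l"
  shows "set ps = orb f g (ps ! 0)"
proof
  have l: "1 \<le> l" "length ps = 2 * l" using ps by (auto simp: alternates_def)
  have f_step: "ps ! (2 * i + 1) = f (ps ! (2 * i))" if "i < l" for i using ps that by (simp add: alternates_def)
  have g_step: "ps ! (2 * i + 2) = g (ps ! (2 * i + 1))" if "Suc i < l" for i
  proof -
    have "i < l" using that by simp
    then have "ps ! ((2 * i + 2) mod (2 * l)) = g (ps ! (2 * i + 1))" using ps unfolding alternates_def by blast
    then show ?thesis using that by simp
  qed
  have g_last: "ps ! 0 = g (ps ! (2 * (l - 1) + 1))"
  proof -
    have "ps ! ((2 * (l - 1) + 2) mod (2 * l)) = g (ps ! (2 * (l - 1) + 1))"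
      using ps l unfolding alternates_def by (metis diff_less less_le_trans zero_less_one)
    moreover have "2 * (l - 1) + 2 = 2 * l" using l by simp
    ultimately show ?thesis by simp
  qed
  have orb: "ps ! (2 * i) \<in> orb f g (ps ! 0)" if "i < l" for i
    using that
  proof (induction i)
    case (Suc i)
    then have "ps ! (2 * i + 1) \<in> orb f g (ps ! 0)" using f_step[of i] orb_step(1) by fastforce
    then have "g (ps ! (2 * i + 1)) \<in> orb f g (ps ! 0)" by (rule orb_step(2))
    then show ?case using g_step[of i] Suc.prems by simp
  qed simp
  have even_odd: "\<exists>i < l. k = 2 * i \<or> k = 2 * i + 1" if "k < 2 * l" for k
    using that by (intro exI[of _ "k div 2"]) auto
  show "set ps \<subseteq> orb f g (ps ! 0)"
  proof
    fix v assume "v \<in> set ps"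
    then obtain k where k: "k < 2 * l" "v = ps ! k" using l by (auto simp: in_set_conv_nth)
    obtain i where i: "i < l" "k = 2 * i \<or> k = 2 * i + 1" using even_odd[OF k(1)] by blast
    have "f (ps ! (2 * i)) \<in> orb f g (ps ! 0)" by (rule orb_step(1)[OF orb[OF i(1)]])
    then show "v \<in> orb f g (ps ! 0)" using i(2) orb[OF i(1)] f_step[OF i(1)] k(2) by metis
  qed
  have mem: "ps ! k \<in> set ps" if "k < 2 * l" for k using l that by simp
  show "orb f g (ps ! 0) \<subseteq> set ps"
  proof (rule orb_subset)
    show "ps ! 0 \<in> set ps" using mem[of 0] l by simp
    fix v assume "v \<in> set ps"
    then obtain k where k: "k < 2 * l" "v = ps ! k" using l by (auto simp: in_set_conv_nth)
    obtain i where i: "i < l" "k = 2 * i \<or> k = 2 * i + 1" using even_odd[OF k(1)] by blast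
    have m: "ps ! (2 * i) \<in> set ps" "ps ! (2 * i + 1) \<in> set ps" using mem i(1) by auto
    show "f v \<in> set ps" using i(2) m f_step[OF i(1)] k(2) f by metis
    show "g v \<in> set ps"
    proof (cases "k = 2 * i")
      case True
      show ?thesis
      proof (cases i)
        case 0
        then have "g v = ps ! (2 * (l - 1) + 1)" using g_last g True k(2) by simp
        then show ?thesis using mem[of "2 * (l - 1) + 1"] l by simp
      next
        case (Suc j)
        then have "g v = ps ! (2 * j + 1)" using g_step[of j] g True k(2) i(1) by simp
        then show ?thesis using mem[of "2 * j + 1"] Suc i(1) by simp
      qed
    next
      case False
      then have v: "v = ps ! (2 * i + 1)" using i k by simp
      show ?thesis
      proof (cases "Suc i < l")
        case True
        then show ?thesis using g_step[OF True] v mem[of "2 * i + 2"] by simp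
      next
        case False
        then have "i = l - 1" using i(1) by simp
        then show ?thesis using g_last v mem[of 0] l by simp
      qed
    qed
  qed
qed

text \<open>The walk alternates \<open>f\<close> and \<open>g\<close> from \<open>v\<close> until
  the first return of \<open>g \<circ> f\<close>, which exists since a finite permutation has finite
  order.\<close>

lemma ex_alternates:
  assumes f: "\<And>v. f (f v) = v" "\<And>v. f v \<noteq> v" and g: "\<And>v. g (g v) = v" "\<And>v. g v \<noteq> v"
    and perm: "permutation (g \<circ> f)"
  obtains ps l where "alternates f g ps l" "distinct ps" "ps ! 0 = v"
proof -
  define h where "h i = ((g \<circ> f) ^^ i) v" for i
  have h_Suc: "h (Suc i) = g (f (h i))" for i by (simp add: h_def)
  define l where "l = (LEAST l. 0 < l \<and> h l = v)"
  have "\<exists>l. 0 < l \<and> h l = v"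
    using permutation_is_nilpotent[OF perm] unfolding h_def by (metis id_apply)
  then have l: "0 < l" "h l = v" unfolding l_def by (metis (mono_tags, lifting) LeastI_ex)+
  have least: "h i \<noteq> v" if "0 < i" "i < l" for i
    using not_less_Least[of i "\<lambda>l. 0 < l \<and> h l = v"] that unfolding l_def by blast
  have cancel: "h (i + d) = h i \<longleftrightarrow> h d = v" for i d
  proof (induction i)
    case (Suc i)
    then show ?case by (metis h_Suc add_Suc f(1) g(1))
  qed (simp add: h_def)
  have inj: "i = j" if "h i = h j" "i < l" "j < l" for i j
    using that
  proof (induction i j rule: linorder_wlog)
    case (le i j)
    then have "h (j - i) = v" using cancel[of i "j - i"] by simp
    then show ?case using least[of "j - i"] le by (cases "i = j") auto
  qed simp
  have shift: "h (Suc i) = f (h j) \<longleftrightarrow> h i = f (h (Suc j))" for i j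
    by (metis f(1) g(1) h_Suc)
  have base: "h i \<noteq> f (h i)" "h (Suc i) \<noteq> f (h i)" for i
    using f(2)[of "h i"] g(2)[of "f (h i)"] h_Suc[of i] by metis+
  have collect: "h (i + j) = f (h 0) \<longleftrightarrow> h i = f (h j)" for i j
  proof (induction j arbitrary: i)
    case (Suc j)
    show ?case using Suc[of "Suc i"] shift[of i j] by simp
  qed simp
  \<comment> \<open>An even visit never meets an odd one: moving half of the steps to the other side
    would leave a fixed point of \<open>f\<close> or of \<open>g\<close>.\<close>
  have "h s \<noteq> f (h 0)" for s
  proof (cases "even s")
    case True
    then show ?thesis using collect[of "s div 2" "s div 2"] base(1)[of "s div 2"] by (auto elim!: evenE simp: mult_2)
  next
    case False
    then show ?thesis using collect[of "Suc (s div 2)" "s div 2"] base(2)[of "s div 2"] by (auto elim!: oddE simp: mult_2)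
  qed
  then have away: "h i \<noteq> f (h j)" for i j using collect by blast
  define ps where "ps = map (\<lambda>k. if even k then h (k div 2) else f (h (k div 2))) [0..<2 * l]"
  have nth: "ps ! (2 * i) = h i" "ps ! (2 * i + 1) = f (h i)" if "i < l" for i
    using that by (simp_all add: ps_def)
  have "alternates f g ps l"
    unfolding alternates_def
  proof (intro conjI allI impI)
    fix i assume i: "i < l"
    show "ps ! (2 * i + 1) = f (ps ! (2 * i))" using nth[OF i] by simp
    show "ps ! ((2 * i + 2) mod (2 * l)) = g (ps ! (2 * i + 1))"
    proof (cases "Suc i < l")
      case True
      then show ?thesis using nth[of i] nth(1)[of "Suc i"] h_Suc by simp
    next
      case False
      then have "Suc i = l" using i by simp
      then have "(2 * i + 2) mod (2 * l) = 2 * 0" by auto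
      moreover have "h 0 = v" by (simp add: h_def)
      ultimately show ?thesis using nth(2)[OF i] nth(1)[of 0] l h_Suc[of i] \<open>Suc i = l\<close> by simp
    qed
  qed (use l in \<open>auto simp: ps_def\<close>)
  moreover have "distinct ps"
    unfolding ps_def distinct_map
  proof (intro conjI inj_onI)
    fix a b assume ab: "a \<in> set [0..<2 * l]" "b \<in> set [0..<2 * l]"
      "(if even a then h (a div 2) else f (h (a div 2))) = (if even b then h (b div 2) else f (h (b div 2)))"
    have lt: "a div 2 < l" "b div 2 < l" using ab(1,2) by auto
    have par: "even a = even b"
      using ab(3) away[of "a div 2" "b div 2"] away[of "b div 2" "a div 2"] by (auto split: if_splits)
    then have "h (a div 2) = h (b div 2)"
      using ab(3) f(1) by (metis (full_types))
    then have "a div 2 = b div 2" using inj lt by blast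
    then show "a = b" using par by (metis even_two_times_div_two odd_two_times_div_two_succ)
  qed simp
  moreover have "ps ! 0 = v" using nth(1)[of 0] l by (simp add: h_def)
  ultimately show ?thesis using that by blast
qed

section \<open>Edges and cycles of the breakpoint graph, seen on positions\<close>

definition grey :: "int list \<Rightarrow> nat \<Rightarrow> nat" where
  "grey xs p = pos xs (mate (lab xs p))"

context
  fixes n :: nat and xs :: "int list"
  assumes xs: "signed_perm n xs"
begin

lemma bij_pos: "bij (pos xs)"
  using adm_pos[OF xs] adm_bij by blast

lemma grey_grey [simp]: "grey xs (grey xs p) = p" and grey_neq [simp]: "grey xs p \<noteq> p"
  unfolding grey_def using xs by (auto, metis lab_pos mate_neq(1))

lemma grey_pos [simp]: "grey xs (pos xs v) = pos xs (mate v)"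
  using xs by (simp add: grey_def)

lemma pos_in [simp]: "pos xs v < 2 * n + 2 \<longleftrightarrow> v < 2 * n + 2"
  using adm_in[OF adm_pos[OF xs]] .

lemma lab_in [simp]: "lab xs p < 2 * n + 2 \<longleftrightarrow> p < 2 * n + 2"
  using pos_in[of "lab xs p"] xs by simp

lemma grey_in [simp]: "grey xs p < 2 * n + 2 \<longleftrightarrow> p < 2 * n + 2"
  unfolding grey_def using pos_in mate_less_iff lab_in by blast

lemma permutation_grey_mate: "permutation (grey xs \<circ> mate)"
proof -
  have "(grey xs \<circ> mate) permutes {..<2 * n + 2}"
  proof (rule bij_imp_permutes)
    show "(grey xs \<circ> mate) p = p" if "p \<notin> {..<2 * n + 2}" for p
    proof -
      have "\<not> mate p < 2 * n + 2" using that mate_less_iff[of p n] by auto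
      then have "2 * n + 2 \<le> mate p" by (simp only: not_less)
      then show ?thesis using that adm_outside[OF adm_pos[OF xs], of p] signed_permD(1)[OF xs]
        by (simp add: grey_def lab_nth(5))
    qed
    show "bij_betw (grey xs \<circ> mate) {..<2 * n + 2} {..<2 * n + 2}"
    proof (rule bij_betw_byWitness[of _ "mate \<circ> grey xs"])
      show "(grey xs \<circ> mate) ` {..<2 * n + 2} \<subseteq> {..<2 * n + 2}" "(mate \<circ> grey xs) ` {..<2 * n + 2} \<subseteq> {..<2 * n + 2}"
        by (intro image_subsetI; simp only: lessThan_iff comp_apply grey_in mate_less_iff)+
    qed simp_all
  qed
  then show ?thesis unfolding permutation_permutes by blast
qed

lemma black_edges_eq: "black_edges xs = {{p, mate p} | p. p < 2 * n + 2}"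
proof (intro set_eqI iffI)
  fix e assume "e \<in> black_edges xs"
  then obtain i where "i \<le> n" "e = {2 * i, 2 * i + 1}"
    using signed_permD(1)[OF xs] by (auto simp: black_edges_def)
  then show "e \<in> {{p, mate p} | p. p < 2 * n + 2}"
    by (intro CollectI exI[of _ "2 * i"]) auto
next
  fix e assume "e \<in> {{p, mate p} | p. p < 2 * n + 2}"
  then obtain p where p: "p < 2 * n + 2" "e = {p, mate p}" by auto
  then have "e = {2 * (p div 2), 2 * (p div 2) + 1}"
    by (auto simp: mate_def elim!: evenE oddE)
  then show "e \<in> black_edges xs"
    using p(1) signed_permD(1)[OF xs] by (auto simp: black_edges_def intro!: exI[of _ "p div 2"])
qed

lemma labels_eq_iff: "p < 2 * n + 2 \<Longrightarrow> labels xs ! p = int w \<longleftrightarrow> lab xs p = w"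
proof -
  assume p: "p < 2 * n + 2"
  have len: "length xs = n" using signed_permD(1)[OF xs] .
  have "labels xs ! p \<ge> 0"
    using p
  proof (cases rule: position_cases[where p = p and n = n])
    case 2
    then show ?thesis using labels_nth(2)[of xs] len by simp
  next
    case (4 i)
    then show ?thesis using labels_nth(3)[of i xs] len by auto
  next
    case (5 i)
    then have "xs ! i \<noteq> 0" using signed_permD(2)[OF xs] by blast
    then show ?thesis using 5 labels_nth(4)[of i xs] len by auto
  qed (use labels_nth(1) in auto)
  then show ?thesis using p len by (auto simp: lab_def)
qed

lemma grey_edges_eq: "grey_edges xs = {{p, grey xs p} | p. p < 2 * n + 2}"
proof (intro set_eqI iffI)
  have len: "length (labels xs) = 2 * n + 2" "length xs = n" using signed_permD(1)[OF xs] by simp_all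
  {
    fix e assume "e \<in> grey_edges xs"
    then obtain p q k where e: "p < 2 * n + 2" "q < 2 * n + 2" "e = {p, q}"
      "labels xs ! p = int (2 * k)" "labels xs ! q = int (2 * k + 1)"
      using len by (auto simp: grey_edges_def)
    then have "lab xs p = 2 * k" "lab xs q = 2 * k + 1" by (simp_all only: labels_eq_iff)
    then have "q = grey xs p" using xs pos_lab[OF xs, of q] by (simp add: grey_def)
    then show "e \<in> {{p, grey xs p} | p. p < 2 * n + 2}" using e by blast
  next
    fix e assume "e \<in> {{p, grey xs p} | p. p < 2 * n + 2}"
    then obtain p where p: "p < 2 * n + 2" "e = {p, grey xs p}" by auto
    define q where "q = (if even (lab xs p) then p else grey xs p)"
    have "e = {q, grey xs q}" "q < 2 * n + 2" "even (lab xs q)"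
      using p xs grey_in[of p] by (auto simp: q_def grey_def)
    moreover define k where "k = lab xs q div 2"
    ultimately have "lab xs q = 2 * k" "lab xs (grey xs q) = 2 * k + 1" "k \<le> n"
      using xs lab_in[of q] by (auto simp: grey_def elim!: evenE)
    then have "labels xs ! q = int (2 * k)" "labels xs ! grey xs q = int (2 * k + 1)"
      using \<open>q < 2 * n + 2\<close> grey_in[of q] by (simp_all only: labels_eq_iff)
    then show "e \<in> grey_edges xs"
      using \<open>e = {q, grey xs q}\<close> \<open>q < 2 * n + 2\<close> grey_in[of q] \<open>k \<le> n\<close> len unfolding grey_edges_def
      by (intro CollectI exI[of _ q] exI[of _ "grey xs q"] conjI exI[of _ k]) auto
  }
qed

lemma black_edge_iff: "{p, q} \<in> black_edges xs \<longleftrightarrow> p < 2 * n + 2 \<and> q = mate p"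
  unfolding black_edges_eq using mate_less_iff[of _ n] by (auto simp: doubleton_eq_iff)

lemma grey_edge_iff: "{p, q} \<in> grey_edges xs \<longleftrightarrow> p < 2 * n + 2 \<and> q = grey xs p"
proof
  assume "{p, q} \<in> grey_edges xs"
  then obtain r where r: "r < 2 * n + 2" "{p, q} = {r, grey xs r}" unfolding grey_edges_eq by blast
  then consider "p = r" "q = grey xs r" | "p = grey xs r" "q = r" by (auto simp: doubleton_eq_iff)
  then show "p < 2 * n + 2 \<and> q = grey xs p" using r(1) grey_in[of r] by cases simp_all
qed (auto simp: grey_edges_eq)

lemma alternating_cycle_iff:
  "alternating_cycle xs ps \<longleftrightarrow> distinct ps \<and> ps ! 0 < 2 * n + 2 \<and> (\<exists>l. alternates mate (grey xs) ps l)"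
proof
  assume "alternating_cycle xs ps"
  then obtain l where l: "distinct ps" "1 \<le> l" "length ps = 2 * l"
    "\<And>i. i < l \<Longrightarrow> {ps ! (2 * i), ps ! (2 * i + 1)} \<in> black_edges xs"
    "\<And>i. i < l \<Longrightarrow> {ps ! (2 * i + 1), ps ! ((2 * i + 2) mod (2 * l))} \<in> grey_edges xs"
    unfolding alternating_cycle_def by blast
  have "ps ! (2 * 0) < 2 * n + 2" using l(4)[of 0] l(2) unfolding black_edge_iff by simp
  moreover have "alternates mate (grey xs) ps l"
    using l(2-5) unfolding black_edge_iff grey_edge_iff alternates_def by blast
  ultimately show "distinct ps \<and> ps ! 0 < 2 * n + 2 \<and> (\<exists>l. alternates mate (grey xs) ps l)"
    using l(1) by auto
next
  assume r: "distinct ps \<and> ps ! 0 < 2 * n + 2 \<and> (\<exists>l. alternates mate (grey xs) ps l)"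
  then obtain l where l: "alternates mate (grey xs) ps l" by blast
  have "set ps = orb mate (grey xs) (ps ! 0)" by (rule set_alternates[OF _ _ l]) simp_all
  also have "\<dots> \<subseteq> {..<2 * n + 2}"
    by (rule orb_subset) (simp_all only: r lessThan_iff grey_in mate_less_iff)
  finally have sub: "set ps \<subseteq> {..<2 * n + 2}" .
  have "ps ! k < 2 * n + 2" if "k < 2 * l" for k
  proof -
    have "ps ! k \<in> set ps" using that l by (intro nth_mem) (simp add: alternates_def)
    then show ?thesis using sub by blast
  qed
  then show "alternating_cycle xs ps"
    using r l grey_in mate_less_iff unfolding alternating_cycle_def black_edge_iff grey_edge_iff alternates_def
    by (intro conjI exI[of _ l] allI impI) auto
qed

lemma cycles_eq: "cycles xs = orb mate (grey xs) ` {..<2 * n + 2}"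
proof (intro set_eqI iffI)
  fix C assume "C \<in> cycles xs"
  then obtain ps l where ps: "C = set ps" "ps ! 0 < 2 * n + 2" "alternates mate (grey xs) ps l"
    by (auto simp: cycles_def alternating_cycle_iff)
  have "set ps = orb mate (grey xs) (ps ! 0)" by (rule set_alternates[OF _ _ ps(3)]) simp_all
  then show "C \<in> orb mate (grey xs) ` {..<2 * n + 2}" using ps by auto
next
  fix C assume "C \<in> orb mate (grey xs) ` {..<2 * n + 2}"
  then obtain v where v: "v < 2 * n + 2" "C = orb mate (grey xs) v" by auto
  obtain ps l where ps: "alternates mate (grey xs) ps l" "distinct ps" "ps ! 0 = v"
    using ex_alternates[of mate "grey xs" v] permutation_grey_mate by auto
  have "set ps = orb mate (grey xs) (ps ! 0)" by (rule set_alternates[OF _ _ ps(1)]) simp_all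
  then show "C \<in> cycles xs" using ps v unfolding cycles_def alternating_cycle_iff by blast
qed

end

section \<open>Counting cycles and the main theorem\<close>

lemma orb_eq_cyc:
  assumes bij: "bij P" and com: "black_commutes P"
  shows "orb (black P) mate v = cyc P v"
proof
  show "orb (black P) mate v \<subseteq> cyc P v"
    by (rule orb_subset) (use bij in \<open>auto simp: cyc_def commutes[OF com]\<close>)
  have "black P v \<in> orb (black P) mate v" by (rule orb_step(1)) simp
  moreover then have "mate (black P v) \<in> orb (black P) mate v" by (rule orb_step(2))
  moreover have "mate v \<in> orb (black P) mate v" by (rule orb_step(2)) simp
  ultimately show "cyc P v \<subseteq> orb (black P) mate v" by (auto simp: cyc_def)
qed

lemma card_cyc:
  assumes bij: "bij P"
  shows "card (cyc P v) = (if black P v = mate v then 2 else 4)"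
proof (cases "black P v = mate v")
  case False
  then have "mate (black P v) \<noteq> v" by (metis mate_mate)
  with False bij show ?thesis by (auto simp: cyc_def card_insert_if)
next
  case True
  then show ?thesis by (simp add: cyc_def card_insert_if)
qed

text \<open>\<open>cyc P v\<close> already fills an orbit of four labels, so
  \<open>black P (mate v)\<close> is in it; three of the four values are impossible.\<close>

lemma black_commutes_of_card_orb:
  assumes P: "adm n P" and card: "\<And>v. v < 2 * n + 2 \<Longrightarrow> card (orb (black P) mate v) \<le> 4"
  shows "black_commutes P"
  unfolding black_commutes_def
proof
  fix v
  note bij = adm_bij[OF P]
  show "black P (mate v) = mate (black P v)"
  proof (cases "black P v = mate v")
    case True
    then show ?thesis using black_black[OF bij, of v] by simp
  next
    case False
    then have "v \<in> nontrivial P" by (simp add: nontrivial_def)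
    then have v: "v < 2 * n + 2" using nontrivial_subset[OF P] by blast
    let ?O = "orb (black P) mate v"
    have b: "black P v \<in> ?O" and m: "mate v \<in> ?O" by (rule orb_step; simp)+
    have "cyc P v \<subseteq> ?O" using b m orb_step(2)[OF b] by (auto simp: cyc_def)
    moreover have fin: "finite ?O"
      using orb_lt[of "black P" n v] black_in[OF P] v finite_subset by blast
    moreover have "card (cyc P v) = 4" using False by (simp add: card_cyc[OF bij])
    ultimately have "cyc P v = ?O" using card[OF v] by (intro card_seteq) auto
    moreover have "black P (mate v) \<in> ?O" by (rule orb_step(1)[OF m])
    ultimately have "black P (mate v) \<in> cyc P v" by simp
    moreover have "black P (mate v) \<noteq> v" using False black_black[OF bij, of "mate v"] by metis
    moreover have "black P (mate v) \<noteq> black P v"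
      using black_black[OF bij, of "mate v"] black_black[OF bij, of v] by (metis mate_neq(1))
    moreover have "black P (mate v) \<noteq> mate v" using bij by simp
    ultimately show ?thesis by (simp add: cyc_def)
  qed
qed

text \<open>Every cycle has two or four labels. The first equation counts the labels of the larger
  ones, the second is half the count of all \<open>2 * n + 2\<close> labels.\<close>

lemma card_orbits:
  assumes P: "adm n P" and com: "black_commutes P"
  defines "T \<equiv> {C \<in> orb (black P) mate ` {..<2 * n + 2}. card C = 2}"
  shows "card (nontrivial P) + 4 * card T = 4 * num_orbs n (black P)"
    and "n + 1 + card T = 2 * num_orbs n (black P)"
proof -
  note bij = adm_bij[OF P]
  let ?V = "{..<2 * n + 2}" and ?orbs = "orb (black P) mate ` {..<2 * n + 2}"
  define F where "F = {C \<in> ?orbs. card C = 4}"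
  have orb: "orb (black P) mate v = cyc P v" for v by (rule orb_eq_cyc[OF bij com])
  have card: "card (cyc P v) = (if v \<in> nontrivial P then 4 else 2)" for v
    by (simp add: card_cyc[OF bij] nontrivial_def)
  have nt_V: "nontrivial P \<subseteq> ?V" by (rule nontrivial_subset[OF P])
  have cyc_V: "cyc P v \<subseteq> ?V" if "v \<in> ?V" for v
    using orb_lt[of "black P" n v] black_in[OF P] that unfolding orb by blast
  have nt_cyc: "w \<in> nontrivial P \<longleftrightarrow> v \<in> nontrivial P" if "w \<in> cyc P v" for v w
    using card[of w] card[of v] cyc_eq[OF bij com that] by (auto split: if_splits)
  have self: "v \<in> cyc P v" for v by (simp add: cyc_def)
  have disj: "C \<inter> D = {}" if "C \<in> ?orbs" "D \<in> ?orbs" "C \<noteq> D" for C D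
    using that cyc_eq[OF bij com] unfolding orb by blast
  have T: "\<Union>T = ?V - nontrivial P"
  proof (intro set_eqI iffI)
    fix w assume "w \<in> \<Union>T"
    then obtain v where v: "v \<in> ?V" "w \<in> cyc P v" "card (cyc P v) = 2" unfolding T_def orb by blast
    then show "w \<in> ?V - nontrivial P" using cyc_V nt_cyc[OF v(2)] card[of v] by auto
  next
    fix w assume "w \<in> ?V - nontrivial P"
    then show "w \<in> \<Union>T" using self[of w] card[of w] unfolding T_def orb by auto
  qed
  have F: "\<Union>F = nontrivial P"
  proof (intro set_eqI iffI)
    fix w assume "w \<in> \<Union>F"
    then obtain v where v: "v \<in> ?V" "w \<in> cyc P v" "card (cyc P v) = 4" unfolding F_def orb by blast
    then show "w \<in> nontrivial P" using nt_cyc[OF v(2)] card[of v] by (auto split: if_splits)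
  next
    fix w assume "w \<in> nontrivial P"
    then show "w \<in> \<Union>F" using self[of w] card[of w] nt_V unfolding F_def orb by auto
  qed
  have "2 * card T = card (\<Union>T)"
    by (rule card_partition) (use disj T in \<open>auto simp: T_def\<close>)
  moreover have "4 * card F = card (\<Union>F)"
    by (rule card_partition) (use disj F finite_nontrivial[OF P] in \<open>auto simp: F_def\<close>)
  moreover have "card (?V - nontrivial P) + card (nontrivial P) = 2 * n + 2"
    using nt_V finite_nontrivial[OF P] card_mono[OF _ nt_V] by (subst card_Diff_subset) auto
  moreover have "?orbs = T \<union> F" using card unfolding T_def F_def orb by auto
  then have "num_orbs n (black P) = card T + card F"
    unfolding num_orbs_def by (simp only:) (rule card_Un_disjoint; auto simp: T_def F_def)
  ultimately show "card (nontrivial P) + 4 * card T = 4 * num_orbs n (black P)"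
    "n + 1 + card T = 2 * num_orbs n (black P)"
    unfolding T F by linarith+
qed

lemma card_breaks:
  assumes P: "adm n P"
  shows "int (card (breaks n (black P))) = int (card (nontrivial P)) - (if black P 0 = 1 then 0 else 2)"
proof -
  note bij = adm_bij[OF P]
  have nt: "v < 2 * n + 2" if "black P v \<noteq> mate v" for v
    using nontrivial_subset[OF P] that by (auto simp: nontrivial_def)
  have "black P 1 = 0 \<longleftrightarrow> black P 0 = 1" using black_black[OF bij] by metis
  then have eq: "nontrivial P = breaks n (black P) \<union> (if black P 0 = 1 then {} else {0, 1})"
    using nt by (auto simp: nontrivial_def breaks_def) (metis less_one linorder_neqE_nat mate_0 One_nat_def mate_1)+
  have "card (nontrivial P) = card (breaks n (black P)) + (if black P 0 = 1 then 0 else 2)"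
    unfolding eq by (subst card_Un_disjoint) (auto simp: breaks_def)
  then show ?thesis by simp
qed

section \<open>Interleaving, cycles and components, translated to labels\<close>

lemma strictly_between_interval:
  fixes a c p q :: nat
  assumes "a < c" "p < q" "{a, c} \<inter> {p, q} = {}"
  shows "({a..c} \<inter> {p..q} \<noteq> {} \<and> \<not> {a..c} \<subseteq> {p..q} \<and> \<not> {p..q} \<subseteq> {a..c}) \<longleftrightarrow>
     strictly_between a c p \<noteq> strictly_between a c q"
proof -
  have "{a..c} \<inter> {p..q} \<noteq> {} \<longleftrightarrow> a \<le> q \<and> p \<le> c" using assms by auto
  moreover have "{a..c} \<subseteq> {p..q} \<longleftrightarrow> p \<le> a \<and> c \<le> q" "{p..q} \<subseteq> {a..c} \<longleftrightarrow> a \<le> p \<and> q \<le> c" using assms(1,2) by auto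
  ultimately show ?thesis
    by (simp only:, cases "a < p"; cases "c < q"; cases "p < c"; cases "a < q")
      (use assms in \<open>auto simp: strictly_between_def\<close>)
qed

lemma interleaving_edges_iff:
  assumes "a \<noteq> c" "p \<noteq> q" "{a, c} \<inter> {p, q} = {}"
  shows "interleaving_edges {a, c} {p, q} \<longleftrightarrow> strictly_between a c p \<noteq> strictly_between a c q"
proof -
  have less: "interleaving_edges {a, c} {p, q} \<longleftrightarrow> strictly_between a c p \<noteq> strictly_between a c q"
    if "a < c" "p < q" "{a, c} \<inter> {p, q} = {}" for a c p q
  proof -
    have "{a, c} \<noteq> {p, q}" using that(3) by auto
    moreover have "Defs.support {a, c} = {a..c}" "Defs.support {p, q} = {p..q}"
      using that(1,2) by (simp_all add: Defs.support_def)
    ultimately show ?thesis using strictly_between_interval[OF that] by (simp add: interleaving_edges_def)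
  qed
  have less_left: "interleaving_edges {a, c} {p, q} \<longleftrightarrow> strictly_between a c p \<noteq> strictly_between a c q"
    if "a < c" "p \<noteq> q" "{a, c} \<inter> {p, q} = {}" for a c p q
  proof (cases "p < q")
    case False
    then have "q < p" using that(2) by simp
    then show ?thesis using less[of a c q p] that by (simp add: insert_commute) blast
  qed (use less that in blast)
  show ?thesis
  proof (cases "a < c")
    case False
    then have "c < a" using assms(1) by simp
    then show ?thesis
      using less_left[of c a p q] assms strictly_between_comm[of a c] by (simp add: insert_commute)
  qed (use less_left assms in blast)
qed

context
  fixes n :: nat and xs :: "int list"
  assumes xs: "signed_perm n xs"
begin

definition cycle_at :: "nat \<Rightarrow> nat set" where
  "cycle_at v = pos xs ` orb (black (pos xs)) mate v"

lemma orb_position: "orb mate (grey xs) (pos xs v) = cycle_at v"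
proof
  note bij = bij_pos[OF xs]
  show "orb mate (grey xs) (pos xs v) \<subseteq> cycle_at v"
  proof (rule orb_subset)
    fix p assume "p \<in> cycle_at v"
    then obtain u where u: "u \<in> orb (black (pos xs)) mate v" "p = pos xs u" by (auto simp: cycle_at_def)
    show "mate p \<in> cycle_at v"
      using orb_step(1)[OF u(1)] P_black[OF bij, of u] u(2) unfolding cycle_at_def by (metis image_eqI)
    show "grey xs p \<in> cycle_at v"
      using orb_step(2)[OF u(1)] grey_pos[OF xs, of u] u(2) unfolding cycle_at_def by (metis image_eqI)
  qed (auto simp: cycle_at_def)
  show "cycle_at v \<subseteq> orb mate (grey xs) (pos xs v)"
  proof
    fix p assume "p \<in> cycle_at v"
    then obtain u where "u \<in> orb (black (pos xs)) mate v" "p = pos xs u" by (auto simp: cycle_at_def)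
    then show "p \<in> orb mate (grey xs) (pos xs v)"
    proof (induction arbitrary: p rule: orb_induct)
      case (left u)
      then show ?case using orb_step(1)[of "pos xs u" mate] P_black[OF bij, of u] by metis
    next
      case (right u)
      then show ?case using orb_step(2)[of "pos xs u" mate] grey_pos[OF xs, of u] by metis
    qed simp
  qed
qed

lemma cycles_eq': "cycles xs = cycle_at ` {..<2 * n + 2}"
proof -
  have "pos xs ` {..<2 * n + 2} = {..<2 * n + 2}"
    using adm_pos[OF xs] unfolding adm_def by (simp add: permutes_image)
  then have "cycles xs = orb mate (grey xs) ` pos xs ` {..<2 * n + 2}" using cycles_eq[OF xs] by simp
  then show ?thesis by (simp add: image_image orb_position)
qed

lemma cycle_at_subset: "v < 2 * n + 2 \<Longrightarrow> cycle_at v \<subseteq> {..<2 * n + 2}"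
  using orb_lt[of "black (pos xs)" n v] black_in[OF adm_pos[OF xs]] pos_in[OF xs]
  unfolding cycle_at_def by blast

lemma card_cycle_at: "card (cycle_at v) = card (orb (black (pos xs)) mate v)"
  unfolding cycle_at_def by (rule card_image) (rule inj_on_subset[OF bij_is_inj[OF bij_pos[OF xs]]], simp)

lemma double_cycle_length:
  assumes "v < 2 * n + 2"
  shows "2 * cycle_length xs (cycle_at v) = card (cycle_at v)"
proof -
  let ?C = "cycle_at v"
  have sub: "?C \<subseteq> {..<2 * n + 2}" using cycle_at_subset[OF assms] .
  have m: "mate p \<in> ?C" if "p \<in> ?C" for p
    using that orb_step(1)[of p mate "grey xs" "pos xs v"] unfolding orb_position by simp
  have "cycle_black_edges xs ?C = (\<lambda>p. {p, mate p}) ` {p \<in> ?C. even p}"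
  proof (intro set_eqI iffI)
    fix e assume "e \<in> cycle_black_edges xs ?C"
    then obtain p where p: "e = {p, mate p}" "p \<in> ?C"
      unfolding cycle_black_edges_def black_edges_eq[OF xs] by auto
    show "e \<in> (\<lambda>p. {p, mate p}) ` {p \<in> ?C. even p}"
    proof (cases "even p")
      case False
      then show ?thesis using p m[OF p(2)] by (intro image_eqI[of _ _ "mate p"]) auto
    qed (use p in auto)
  next
    fix e assume "e \<in> (\<lambda>p. {p, mate p}) ` {p \<in> ?C. even p}"
    then obtain p where "e = {p, mate p}" "p \<in> ?C" by auto
    then show "e \<in> cycle_black_edges xs ?C"
      using m[of p] sub unfolding cycle_black_edges_def black_edges_eq[OF xs] by auto
  qed
  moreover have "inj_on (\<lambda>p. {p, mate p}) {p \<in> ?C. even p}"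
    by (rule inj_onI) (auto simp: doubleton_eq_iff)
  ultimately have "cycle_length xs ?C = card {p \<in> ?C. even p}"
    by (simp add: cycle_length_def card_image)
  then show ?thesis using card_mate_closed[of ?C] m finite_subset[OF sub] by simp
qed

lemma black_commutes_of_simple:
  assumes "simple_perm xs"
  shows "black_commutes (pos xs)"
proof (rule black_commutes_of_card_orb[OF adm_pos[OF xs]])
  fix v assume v: "v < 2 * n + 2"
  then have "cycle_length xs (cycle_at v) \<le> 2"
    using assms unfolding simple_perm_def cycles_eq' by blast
  then show "card (orb (black (pos xs)) mate v) \<le> 4"
    using double_cycle_length[OF v] card_cycle_at[of v] by linarith
qed

lemma num_cycles_eq: "num_cycles xs = num_orbs n (black (pos xs))"
  and num_1_cycles_eq: "num_1_cycles xs = card {C \<in> orb (black (pos xs)) mate ` {..<2 * n + 2}. card C = 2}"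
proof -
  have inj: "inj_on ((`) (pos xs)) S" for S
    using bij_is_inj[OF bij_pos[OF xs]] by (meson inj_image_eq_iff inj_onI)
  have "cycles xs = (`) (pos xs) ` orb (black (pos xs)) mate ` {..<2 * n + 2}"
    unfolding cycles_eq' cycle_at_def[abs_def] by (simp add: image_image)
  then show "num_cycles xs = num_orbs n (black (pos xs))"
    unfolding num_cycles_def num_orbs_def by (simp add: card_image[OF inj])
  have iff: "cycle_length xs (cycle_at v) = 1 \<longleftrightarrow> card (orb (black (pos xs)) mate v) = 2" if "v < 2 * n + 2" for v
    using double_cycle_length[OF that] card_cycle_at[of v] by linarith
  have "{C \<in> cycles xs. cycle_length xs C = 1} =
      (`) (pos xs) ` {C \<in> orb (black (pos xs)) mate ` {..<2 * n + 2}. card C = 2}"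
  proof (intro set_eqI iffI)
    fix C assume "C \<in> {C \<in> cycles xs. cycle_length xs C = 1}"
    then obtain v where "v < 2 * n + 2" "C = cycle_at v" "cycle_length xs (cycle_at v) = 1"
      unfolding cycles_eq' by auto
    then show "C \<in> (`) (pos xs) ` {C \<in> orb (black (pos xs)) mate ` {..<2 * n + 2}. card C = 2}"
      using iff[of v] unfolding cycle_at_def by blast
  next
    fix C assume "C \<in> (`) (pos xs) ` {C \<in> orb (black (pos xs)) mate ` {..<2 * n + 2}. card C = 2}"
    then obtain v where "v < 2 * n + 2" "C = cycle_at v" "card (orb (black (pos xs)) mate v) = 2"
      unfolding cycle_at_def by auto
    then show "C \<in> {C \<in> cycles xs. cycle_length xs C = 1}" using iff[of v] unfolding cycles_eq' by auto
  qed
  then show "num_1_cycles xs = card {C \<in> orb (black (pos xs)) mate ` {..<2 * n + 2}. card C = 2}"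
    unfolding num_1_cycles_def by (simp add: card_image[OF inj])
qed

lemma cycle_grey_edges_eq:
  assumes "v < 2 * n + 2"
  shows "cycle_grey_edges xs (cycle_at v) = {{pos xs u, pos xs (mate u)} | u. u \<in> orb (black (pos xs)) mate v}"
proof (intro set_eqI iffI)
  fix e assume "e \<in> cycle_grey_edges xs (cycle_at v)"
  then obtain p where p: "e = {p, grey xs p}" "p \<in> cycle_at v"
    unfolding cycle_grey_edges_def grey_edges_eq[OF xs] by auto
  then obtain u where "u \<in> orb (black (pos xs)) mate v" "p = pos xs u" unfolding cycle_at_def by auto
  then show "e \<in> {{pos xs u, pos xs (mate u)} | u. u \<in> orb (black (pos xs)) mate v}"
    using p(1) grey_pos[OF xs, of u] by auto
next
  fix e assume "e \<in> {{pos xs u, pos xs (mate u)} | u. u \<in> orb (black (pos xs)) mate v}"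
  then obtain u where u: "e = {pos xs u, pos xs (mate u)}" "u \<in> orb (black (pos xs)) mate v" by auto
  then have "pos xs u \<in> cycle_at v" "pos xs (mate u) \<in> cycle_at v"
    using orb_step(2)[OF u(2)] unfolding cycle_at_def by auto
  then show "e \<in> cycle_grey_edges xs (cycle_at v)"
    using u(1) cycle_at_subset[OF assms] grey_pos[OF xs, of u]
    unfolding cycle_grey_edges_def grey_edges_eq[OF xs] by auto
qed

lemma interleaving_edges_pos:
  "interleaving_edges {pos xs u, pos xs (mate u)} {pos xs v, pos xs (mate v)} \<longleftrightarrow> crosses (pos xs) u v"
proof (cases "v = u \<or> v = mate u")
  case True
  then have "\<not> crosses (pos xs) u v" using crosses_distinct by blast
  moreover have "{pos xs u, pos xs (mate u)} = {pos xs v, pos xs (mate v)}" using True by auto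
  ultimately show ?thesis by (simp add: interleaving_edges_def)
next
  case False
  then have "mate v \<noteq> u" by auto
  with False show ?thesis
    unfolding crosses_def by (intro interleaving_edges_iff) (auto simp: inj_P_iff[OF bij_pos[OF xs]])
qed

lemma interleaving_cycles_iff:
  assumes "u < 2 * n + 2" "v < 2 * n + 2"
  shows "interleaving_cycles xs (cycle_at u) (cycle_at v) \<longleftrightarrow>
    (\<exists>u' \<in> orb (black (pos xs)) mate u. \<exists>v' \<in> orb (black (pos xs)) mate v. crosses (pos xs) u' v')"
  unfolding interleaving_cycles_def cycle_grey_edges_eq[OF assms(1)] cycle_grey_edges_eq[OF assms(2)]
  by (auto simp: interleaving_edges_pos[symmetric])

lemma cycle_at_eq: "u \<in> orb (black (pos xs)) mate v \<Longrightarrow> cycle_at u = cycle_at v"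
  unfolding cycle_at_def using orb_eq[of "black (pos xs)" mate u v] bij_pos[OF xs] by simp

lemma crosses_less:
  assumes "u < 2 * n + 2" "crosses (pos xs) u v"
  shows "v < 2 * n + 2"
proof -
  have b: "pos xs u < 2 * n + 2" "pos xs (mate u) < 2 * n + 2"
    using assms(1) pos_in[OF xs] mate_less_iff by blast+
  have "pos xs v < 2 * n + 2 \<or> pos xs (mate v) < 2 * n + 2"
    using assms(2) b unfolding crosses_def strictly_between_def by linarith
  then show ?thesis using pos_in[OF xs] mate_less_iff by blast
qed

lemma interleaving_star_leftmost:
  "(cycle_at 0, C) \<in> (interleaving_rel xs)\<^sup>* \<longleftrightarrow> (\<exists>v \<in> leftmost_labels (pos xs). v < 2 * n + 2 \<and> C = cycle_at v)"
proof
  assume "(cycle_at 0, C) \<in> (interleaving_rel xs)\<^sup>*"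
  then show "\<exists>v \<in> leftmost_labels (pos xs). v < 2 * n + 2 \<and> C = cycle_at v"
  proof (induction rule: rtrancl_induct)
    case base
    then show ?case by (intro bexI[of _ 0]) auto
  next
    case (step C D)
    then obtain v where v: "v \<in> leftmost_labels (pos xs)" "v < 2 * n + 2" "C = cycle_at v" by blast
    have "D \<in> cycles xs" "interleaving_cycles xs C D" using step(2) by (auto simp: interleaving_rel_def)
    then obtain w where w: "w < 2 * n + 2" "D = cycle_at w" unfolding cycles_eq' by auto
    obtain v' w' where vw: "v' \<in> orb (black (pos xs)) mate v" "w' \<in> orb (black (pos xs)) mate w" "crosses (pos xs) v' w'"
      using \<open>interleaving_cycles xs C D\<close> interleaving_cycles_iff[OF v(2) w(1)] v(3) w(2) by blast
    have "v' \<in> leftmost_labels (pos xs)"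
      using vw(1)
      by (induction rule: orb_induct) (use v(1) leftmost_labels_step(1,2) in blast)+
    then have "w' \<in> leftmost_labels (pos xs)" using vw(3) by (rule leftmost_labels_step(3))
    moreover have "w' < 2 * n + 2"
      using vw(2) orb_lt[of "black (pos xs)" n w] black_in[OF adm_pos[OF xs]] w(1) by blast
    ultimately show ?case using cycle_at_eq[OF vw(2)] w(2) by (intro bexI[of _ w']) auto
  qed
next
  assume "\<exists>v \<in> leftmost_labels (pos xs). v < 2 * n + 2 \<and> C = cycle_at v"
  then obtain v where v: "v \<in> leftmost_labels (pos xs)" "C = cycle_at v" by blast
  have "v < 2 * n + 2 \<and> (cycle_at 0, cycle_at v) \<in> (interleaving_rel xs)\<^sup>*"
    using v(1)
  proof (induction rule: leftmost_labels_induct)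
    case (black u)
    have "cycle_at (black (pos xs) u) = cycle_at u" by (rule cycle_at_eq) (rule orb_step(1), simp)
    with black show ?case using black_in[OF adm_pos[OF xs], of u] by simp
  next
    case (mate u)
    have "cycle_at (mate u) = cycle_at u" by (rule cycle_at_eq) (rule orb_step(2), simp)
    with mate show ?case using mate_less_iff[of u n] by simp
  next
    case (crosses u w)
    have u: "u < 2 * n + 2" using crosses by blast
    have w: "w < 2 * n + 2" using crosses_less[OF u] crosses by blast
    have "crosses (pos xs) u w" using crosses by blast
    then have "interleaving_cycles xs (cycle_at u) (cycle_at w)"
      unfolding interleaving_cycles_iff[OF u w] by (intro bexI[of _ u] bexI[of _ w] orb_self)
    then have "(cycle_at u, cycle_at w) \<in> interleaving_rel xs"
      using u w unfolding interleaving_rel_def cycles_eq' by blast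
    then show ?case using crosses w by (meson rtrancl_into_rtrancl)
  qed simp
  then show "(cycle_at 0, C) \<in> (interleaving_rel xs)\<^sup>*" using v(2) by blast
qed

lemma leftmost_cycle_eq: "leftmost_cycle xs = cycle_at 0"
  unfolding leftmost_cycle_def
proof (rule the_equality)
  have pos0: "pos xs 0 = 0" using adm_0[OF adm_pos[OF xs]] .
  have "pos xs 0 \<in> cycle_at 0" "pos xs (black (pos xs) 0) \<in> cycle_at 0"
    unfolding cycle_at_def by (rule imageI, simp, rule imageI, rule orb_step(1), simp)
  then have "{0, 1} \<subseteq> cycle_at 0" using pos0 P_black[OF bij_pos[OF xs], of 0] by simp
  moreover have "{0, 1} \<in> black_edges xs" unfolding black_edges_eq[OF xs] by (auto intro!: exI[of _ 0])
  ultimately show "cycle_at 0 \<in> cycles xs \<and> {0, 1} \<in> cycle_black_edges xs (cycle_at 0)"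
    unfolding cycles_eq' cycle_black_edges_def by auto
  fix C assume "C \<in> cycles xs \<and> {0, 1} \<in> cycle_black_edges xs C"
  then obtain v where v: "C = cycle_at v" "0 \<in> cycle_at v" unfolding cycles_eq' cycle_black_edges_def by auto
  then obtain u where "u \<in> orb (black (pos xs)) mate v" "pos xs u = 0" unfolding cycle_at_def by auto
  then have "0 \<in> orb (black (pos xs)) mate v" using pos0 inj_P_iff[OF bij_pos[OF xs], of u 0] by simp
  then show "C = cycle_at 0" using cycle_at_eq v(1) by simp
qed

lemma leftmost_component_eq: "leftmost_component xs = (interleaving_rel xs)\<^sup>* `` {cycle_at 0}"
  unfolding leftmost_component_def leftmost_cycle_eq
proof (rule the_equality)
  have "interleaving_edges e f \<longleftrightarrow> interleaving_edges f e" for e f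
    by (auto simp: interleaving_edges_def)
  then have "sym (interleaving_rel xs)"
    unfolding sym_def interleaving_rel_def interleaving_cycles_def by blast
  \<comment> \<open>Symmetry makes the quotient a partition, so only one class contains the leftmost
    cycle.\<close>
  then have sym: "sym ((interleaving_rel xs)\<^sup>*)" by (rule sym_rtrancl)
  have "cycle_at 0 \<in> cycles xs" unfolding cycles_eq' by auto
  then show "(interleaving_rel xs)\<^sup>* `` {cycle_at 0} \<in> components xs \<and>
      cycle_at 0 \<in> (interleaving_rel xs)\<^sup>* `` {cycle_at 0}"
    unfolding components_def quotient_def by blast
  fix K assume "K \<in> components xs \<and> cycle_at 0 \<in> K"
  then obtain C where C: "K = (interleaving_rel xs)\<^sup>* `` {C}" "(C, cycle_at 0) \<in> (interleaving_rel xs)\<^sup>*"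
    unfolding components_def quotient_def by blast
  then have "(cycle_at 0, C) \<in> (interleaving_rel xs)\<^sup>*" using sym by (auto dest: symD)
  then show "K = (interleaving_rel xs)\<^sup>* `` {cycle_at 0}"
    using C by (auto intro: rtrancl_trans)
qed

lemma oriented_leftmost_component_iff:
  "oriented_component xs (leftmost_component xs) \<longleftrightarrow> (\<exists>v \<in> leftmost_labels (pos xs). oriented (pos xs) v)"
proof -
  have edge: "oriented_edge {pos xs u, pos xs (mate u)} \<longleftrightarrow> oriented (pos xs) u" for u
    unfolding oriented_edge_def oriented_def
    by (cases "pos xs u" "pos xs (mate u)" rule: linorder_cases) auto
  have cyc: "oriented_cycle xs (cycle_at v) \<longleftrightarrow> (\<exists>u \<in> orb (black (pos xs)) mate v. oriented (pos xs) u)"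
    if "v < 2 * n + 2" for v
    unfolding oriented_cycle_def cycle_grey_edges_eq[OF that] by (auto simp: edge[symmetric])
  have less: "v < 2 * n + 2" if "v \<in> leftmost_labels (pos xs)" for v
    using that
  proof (induction rule: leftmost_labels_induct)
    case (black u)
    then show ?case using black_in[OF adm_pos[OF xs]] by blast
  next
    case (mate u)
    then show ?case using mate_less_iff by blast
  next
    case (crosses u v)
    then show ?case using crosses_less by blast
  qed simp
  have closed: "u \<in> leftmost_labels (pos xs)" if "u \<in> orb (black (pos xs)) mate v" "v \<in> leftmost_labels (pos xs)" for u v
    using that(1) by (induction rule: orb_induct) (use that(2) leftmost_labels_step(1,2) in blast)+
  have "oriented_component xs (leftmost_component xs) \<longleftrightarrow>
      (\<exists>v \<in> leftmost_labels (pos xs). v < 2 * n + 2 \<and> oriented_cycle xs (cycle_at v))"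
    unfolding oriented_component_def leftmost_component_eq
    by (auto simp: Image_singleton interleaving_star_leftmost)
  also have "\<dots> \<longleftrightarrow> (\<exists>v \<in> leftmost_labels (pos xs). oriented (pos xs) v)"
  proof
    assume "\<exists>v \<in> leftmost_labels (pos xs). v < 2 * n + 2 \<and> oriented_cycle xs (cycle_at v)"
    then show "\<exists>v \<in> leftmost_labels (pos xs). oriented (pos xs) v" using cyc closed by blast
  next
    assume "\<exists>v \<in> leftmost_labels (pos xs). oriented (pos xs) v"
    then obtain v where v: "v \<in> leftmost_labels (pos xs)" "oriented (pos xs) v" by blast
    then have "oriented_cycle xs (cycle_at v)" unfolding cyc[OF less[OF v(1)]] by (intro bexI[of _ v] orb_self)
    then show "\<exists>v \<in> leftmost_labels (pos xs). v < 2 * n + 2 \<and> oriented_cycle xs (cycle_at v)"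
      using v(1) less by blast
  qed
  finally show ?thesis .
qed

lemma hd_eq_1_iff:
  assumes "n \<ge> 1"
  shows "hd xs = 1 \<longleftrightarrow> black (pos xs) 0 = 1"
proof -
  have len: "length xs = n" using signed_permD(1)[OF xs] .
  have "hd xs = xs ! 0" using assms len by (intro hd_conv_nth) auto
  moreover have "lab xs 1 = nat (if xs ! 0 > 0 then 2 * xs ! 0 - 1 else 2 * \<bar>xs ! 0\<bar>)"
    using lab_nth(3)[of 0 xs] assms len by simp
  then have "lab xs 1 = 1 \<longleftrightarrow> xs ! 0 = 1" by (auto simp: nat_eq_iff split: if_splits) presburger
  moreover have "pos xs 1 = 1 \<longleftrightarrow> lab xs 1 = 1" using lab_pos[OF xs] pos_lab[OF xs] by metis
  ultimately show ?thesis using adm_1_iff[OF adm_pos[OF xs]] by simp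
qed

end

theorem theorem3:
  fixes n :: nat and xs :: "int list"
  assumes "n \<ge> 1"
    and "signed_perm n xs"
    and "simple_perm xs"
  shows "int (psrd xs) =
    int n + 1 + int (num_cycles xs) - 2 * int (num_1_cycles xs) + int (t_correction xs)
      - (if hd xs = 1 then 0 else 2)"
    (is "_ = ?d")
proof -
  let ?P = "pos xs"
  have P: "adm n ?P" by (rule adm_pos[OF assms(2)])
  have com: "black_commutes ?P" by (rule black_commutes_of_simple[OF assms(2,3)])
  have hd: "hd xs = 1 \<longleftrightarrow> black ?P 0 = 1" by (rule hd_eq_1_iff[OF assms(2,1)])
  have counts: "int (card (nontrivial ?P)) + 4 * int (num_1_cycles xs) = 4 * int (num_cycles xs)"
    "int n + 1 + int (num_1_cycles xs) = 2 * int (num_cycles xs)"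
    using card_orbits[OF P com] unfolding num_cycles_eq[OF assms(2)] num_1_cycles_eq[OF assms(2)] by linarith+
  \<comment> \<open>With F cycles of length two, \<open>counts\<close> says that
    \<open>nontrivial ?P\<close> has 4 F labels and that \<open>n + 1 + c - 2 c_1\<close> is 3
    F.\<close>
  have cost: "cost ?P = 4 * ?d"
    using counts unfolding cost_def hd t_correction_def oriented_leftmost_component_iff[OF assms(2)]
    by (auto simp: algebra_simps)
  have potential: "potential n (black ?P) + int (t_correction xs) = ?d"
    using counts card_breaks[OF P] unfolding potential_def hd num_cycles_eq[OF assms(2), symmetric]
    by (auto simp: algebra_simps split: if_splits)
  have lower: "?d \<le> int (length js)" if "sorts js xs" for js
  proof -
    have js: "set js \<subseteq> {1..n}" "flips js ?P = id" using that sorts_iff[OF assms(2)] by auto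
    show ?thesis
    proof (cases "t_correction xs = 0")
      case True
      then show ?thesis using length_ge_potential[OF P js] potential by simp
    next
      case False
      then have t: "t_correction xs = 1" "black ?P 0 \<noteq> 1"
        "\<And>v. v \<in> leftmost_labels ?P \<Longrightarrow> \<not> oriented ?P v"
        using oriented_leftmost_component_iff[OF assms(2)] hd by (auto simp: t_correction_def split: if_splits)
      then have "potential n (black ?P) < int (length js)"
        using length_gt_potential[OF P _ _ P shadows_refl js] adm_1_iff[OF P] by blast
      then show ?thesis using potential t(1) by simp
    qed
  qed
  obtain js where "set js \<subseteq> {1..n}" "flips js ?P = id" "4 * int (length js) \<le> cost ?P"
    using ex_sorting_of_cost[OF P com] by blast
  then have js: "sorts js xs" "int (length js) \<le> ?d" using sorts_iff[OF assms(2)] cost by auto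
  have "psrd xs \<le> length js" unfolding psrd_def using js(1) by (intro Least_le) blast
  moreover have "\<exists>js. length js = psrd xs \<and> sorts js xs"
    unfolding psrd_def by (rule LeastI[of _ "length js"]) (use js(1) in blast)
  ultimately show ?thesis using lower js(2) by fastforce
qed

end
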